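(* Let $v\ge0$ be an integer and $n$ a positive integer with $v_2(n)\ge v$. Let $\lambda$ be an odd partition of $n$. Then the map $\mu\mapsto\mathrm{core}_{2^v}(\mu)$ is an isomorphism of trees $$\lambda^{+[0,2^v-1]}\to\emptyset^{+[0,2^v-1]}.$$
   Context: For a partition $\lambda$, $f_\lambda$ is the number of standard Young tableaux of shape $\lambda$; $\lambda$ is odd if $f_\lambda$ is odd, and $\Lambda^{\mathrm{odd}}$ is the set of odd partitions. The subgraph of Young's graph (Hasse diagram of partitions under containment) induced on $\Lambda^{\mathrm{odd}}$ is a rooted tree. For $\lambda\in\Lambda^{\mathrm{odd}}$ and $k\ge0$, $\lambda^{+[0,k]}$ denotes the induced subgraph (subtree) on the set of $\mu\in\Lambda^{\mathrm{odd}}$ with $\mu\supseteq\lambda$ and $|\lambda|\le|\mu|\le|\lambda|+k$. $v_2$ is the $2$-adic valuation. For $p>1$, $\mathrm{core}_p(\mu)$ is the $p$-core of $\mu$ (obtained by repeatedly removing rim hooks of length $p$ until none remain); $\mathrm{core}_1(\mu)=\emptyset$.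
   Formalization: In $\lambda^{+[0,k]}$ the condition $\mu\supseteq\lambda$ is read as: $\mu$ is a descendant of $\lambda$ in the tree of odd partitions; with plain containment the claim fails, e.g. $v=2$, $\lambda=(4)$, where $(4,2)$ is odd and contains $(4)$ but is not a descendant. *)

theory Defs
  imports "HOL-Library.FuncSet" "HOL-Computational_Algebra.Primes"
begin

definition is_partition :: "nat list \<Rightarrow> bool" where
  "is_partition \<mu> \<longleftrightarrow> sorted_wrt (\<ge>) \<mu> \<and> 0 \<notin> set \<mu>"

text \<open>The size of a partition \<open>\<mu>\<close> is \<^term>\<open>sum_list \<mu>\<close>. Rows and columns of cells
  are numbered from 0, in English convention.\<close>

definition diagram :: "nat list \<Rightarrow> (nat \<times> nat) set" where
  "diagram \<mu> = {(i, j). i < length \<mu> \<and> j < \<mu> ! i}"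

text \<open>Requiring \<open>extensional\<close> makes a tableau determined by its entries inside the shape, so
  that cardinality counts tableaux.\<close>

definition standard_tableaux :: "nat list \<Rightarrow> (nat \<times> nat \<Rightarrow> nat) set" where
  "standard_tableaux \<mu> =
     {T \<in> extensional (diagram \<mu>).
        bij_betw T (diagram \<mu>) {1..sum_list \<mu>} \<and>
        (\<forall>i j j'. (i, j) \<in> diagram \<mu> \<and> (i, j') \<in> diagram \<mu> \<and> j < j' \<longrightarrow> T (i, j) < T (i, j')) \<and>
        (\<forall>i i' j. (i, j) \<in> diagram \<mu> \<and> (i', j) \<in> diagram \<mu> \<and> i < i' \<longrightarrow> T (i, j) < T (i', j))}"

definition num_syt :: "nat list \<Rightarrow> nat" where
  "num_syt \<mu> = card (standard_tableaux \<mu>)"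

definition odd_partitions :: "nat list set" where
  "odd_partitions = {\<mu>. is_partition \<mu> \<and> odd (num_syt \<mu>)}"

definition contained_in :: "nat list \<Rightarrow> nat list \<Rightarrow> bool" where
  "contained_in \<mu> \<nu> \<longleftrightarrow> diagram \<mu> \<subseteq> diagram \<nu>"

definition young_covers :: "nat list \<Rightarrow> nat list \<Rightarrow> bool" where
  "young_covers \<mu> \<nu> \<longleftrightarrow>
     is_partition \<mu> \<and> is_partition \<nu> \<and> contained_in \<mu> \<nu> \<and> \<mu> \<noteq> \<nu> \<and>
     (\<forall>\<kappa>. is_partition \<kappa> \<and> contained_in \<mu> \<kappa> \<and> contained_in \<kappa> \<nu> \<longrightarrow> \<kappa> = \<mu> \<or> \<kappa> = \<nu>)"

definition young_edges :: "nat list set set" where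
  "young_edges = {{\<mu>, \<nu>} | \<mu> \<nu>. young_covers \<mu> \<nu>}"

text \<open>A rooted graph is a triple of vertices, edges (two-element sets of vertices) and root.\<close>

type_synonym 'a rooted_graph = "'a set \<times> 'a set set \<times> 'a"

definition young_induced :: "nat list set \<Rightarrow> nat list \<Rightarrow> nat list rooted_graph" where
  "young_induced V r = (V, {e \<in> young_edges. e \<subseteq> V}, r)"

text \<open>The order of the tree of odd partitions: \<open>\<mu>\<close> lies below \<open>\<nu>\<close> if \<open>\<nu>\<close> is reached from \<open>\<mu>\<close> by
  going up through odd partitions along edges of Young's graph. This implies containment but is
  strictly stronger: \<open>[4]\<close> and \<open>[4, 2]\<close> are odd, yet the only odd partition covered by
  \<open>[4, 2]\<close> is \<open>[3, 2]\<close>.\<close>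

definition odd_tree_le :: "nat list \<Rightarrow> nat list \<Rightarrow> bool" where
  "odd_tree_le =
     (\<lambda>\<mu> \<nu>. \<mu> \<in> odd_partitions \<and> \<nu> \<in> odd_partitions \<and> young_covers \<mu> \<nu>)\<^sup>*\<^sup>*"

text \<open>The tree \<open>\<rho>\<^sup>+\<^sup>[\<^sup>0\<^sup>,\<^sup>k\<^sup>]\<close>. The condition \<open>\<mu> \<supseteq> \<rho>\<close> is read in the order of the tree of odd
  partitions; with plain containment the induced subgraph on \<open>[4]\<^sup>+\<^sup>[\<^sup>0\<^sup>,\<^sup>3\<^sup>]\<close> would contain
  \<open>[4, 2]\<close> but not its parent, and so would not be a subtree.\<close>

definition odd_subtree :: "nat list \<Rightarrow> nat \<Rightarrow> nat list rooted_graph" where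
  "odd_subtree \<rho> k =
     young_induced
       {\<mu> \<in> odd_partitions. odd_tree_le \<rho> \<mu> \<and> sum_list \<rho> \<le> sum_list \<mu> \<and> sum_list \<mu> \<le> sum_list \<rho> + k}
       \<rho>"

fun rooted_graph_iso :: "('a \<Rightarrow> 'b) \<Rightarrow> 'a rooted_graph \<Rightarrow> 'b rooted_graph \<Rightarrow> bool" where
  "rooted_graph_iso f (V, E, r) (V', E', r') \<longleftrightarrow>
     bij_betw f V V' \<and>
     (\<forall>x\<in>V. \<forall>y\<in>V. {x, y} \<in> E \<longleftrightarrow> {f x, f y} \<in> E') \<and>
     f r = r'"

fun adjacent_cells :: "nat \<times> nat \<Rightarrow> nat \<times> nat \<Rightarrow> bool" where
  "adjacent_cells (i, j) (k, l) \<longleftrightarrow>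
     (i = k \<and> (l = Suc j \<or> j = Suc l)) \<or> (j = l \<and> (k = Suc i \<or> i = Suc k))"

definition connected_cells :: "(nat \<times> nat) set \<Rightarrow> bool" where
  "connected_cells S \<longleftrightarrow>
     (\<forall>a\<in>S. \<forall>b\<in>S. (a, b) \<in> {(x, y). x \<in> S \<and> y \<in> S \<and> adjacent_cells x y}\<^sup>*)"

definition rim :: "nat list \<Rightarrow> (nat \<times> nat) set" where
  "rim \<mu> = {(i, j) \<in> diagram \<mu>. (Suc i, Suc j) \<notin> diagram \<mu>}"

text \<open>\<open>\<nu>\<close> arises from \<open>\<mu>\<close> by removing a rim hook of length \<open>p\<close>: a connected set of \<open>p\<close> cells
  of the rim whose removal leaves the diagram of a partition.\<close>

definition removes_rim_hook :: "nat \<Rightarrow> nat list \<Rightarrow> nat list \<Rightarrow> bool" where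
  "removes_rim_hook p \<mu> \<nu> \<longleftrightarrow>
     is_partition \<mu> \<and> is_partition \<nu> \<and> contained_in \<nu> \<mu> \<and>
     diagram \<mu> - diagram \<nu> \<subseteq> rim \<mu> \<and>
     connected_cells (diagram \<mu> - diagram \<nu>) \<and>
     card (diagram \<mu> - diagram \<nu>) = p"

definition core :: "nat \<Rightarrow> nat list \<Rightarrow> nat list" where
  "core p \<mu> =
     (if p = 1 then []
      else THE \<nu>. (removes_rim_hook p)\<^sup>*\<^sup>* \<mu> \<nu> \<and> \<not> (\<exists>\<kappa>. removes_rim_hook p \<nu> \<kappa>))"

end

theory Submission
  imports Defs "HOL-Library.Confluence" "HOL-Library.Disjoint_Sets"
begin

text \<open>Encode a partition by its bead set \<open>{\<mu>\<^sub>i - i}\<close> in the integers; removing a rim hook of length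
  \<open>p\<close> moves one bead from \<open>x\<close> to a free place \<open>x - p\<close>. Modulo 2, removing two \<open>p\<close>-hooks in all
  possible ways is the same as removing one \<open>2p\<close>-hook, so \<open>\<mu>\<close> is odd if and only if the number of
  odd partitions obtained from it by removing a \<open>2\<^sup>k\<close>-hook is odd, as long as \<open>2\<^sup>k\<close> is at most
  \<open>|\<mu>|\<close>. If \<open>2\<^sup>k\<close> is the leading binary digit of \<open>|\<mu>|\<close>, there is at most one such hook, and
  stripping it preserves oddness.

  As long as the leading digit does not change, stripping commutes with adding and removing a box.
  It therefore induces a bijection between the odd partitions covering \<open>\<mu>\<close> and those covering the
  stripped \<open>\<mu>\<close>, and by induction on the size every nonempty odd partition covers exactly one odd
  partition. Stripping all digits from \<open>2\<^sup>v\<close> upwards yields the \<open>2\<^sup>v\<close>-core, and the local bijections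
  assemble, level by level, to the isomorphism of trees.\<close>

section \<open>Partitions and their rows\<close>

definition row :: "nat list \<Rightarrow> nat \<Rightarrow> nat" where
  "row \<mu> i = (if i < length \<mu> then \<mu> ! i else 0)"

lemma diagram_row: "diagram \<mu> = {(i, j). j < row \<mu> i}"
  by (auto simp: diagram_def row_def split: if_splits)

lemma diagram_Sigma: "diagram \<mu> = (SIGMA i:{..<length \<mu>}. {..<\<mu> ! i})"
  by (auto simp: diagram_def)

lemma finite_diagram [simp]: "finite (diagram \<mu>)"
  by (simp add: diagram_Sigma)

lemma card_diagram: "card (diagram \<mu>) = sum_list \<mu>"
  by (simp add: diagram_Sigma sum_list_sum_nth atLeast0LessThan)

lemma row_antimono:
  assumes "is_partition \<mu>" "i \<le> j"
  shows "row \<mu> j \<le> row \<mu> i"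
proof (cases "i = j \<or> j \<ge> length \<mu>")
  case True
  then show ?thesis by (auto simp: row_def)
next
  case False
  then have "i < j" "j < length \<mu>" using assms by auto
  then show ?thesis
    using assms by (auto simp: row_def is_partition_def sorted_wrt_iff_nth_less)
qed

lemma row_pos_iff:
  assumes "is_partition \<mu>"
  shows "row \<mu> i > 0 \<longleftrightarrow> i < length \<mu>"
  using assms by (auto simp: row_def is_partition_def in_set_conv_nth)

lemma row_inject:
  assumes "is_partition \<mu>" "is_partition \<nu>" "row \<mu> = row \<nu>"
  shows "\<mu> = \<nu>"
proof (rule nth_equalityI)
  have "i < length \<mu> \<longleftrightarrow> i < length \<nu>" for i
    using row_pos_iff assms by metis
  then show length: "length \<mu> = length \<nu>" by (meson linorder_neq_iff)
  fix i assume "i < length \<mu>"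
  then show "\<mu> ! i = \<nu> ! i"
    using fun_cong[OF assms(3), of i] length by (simp add: row_def)
qed

lemma contained_in_row: "contained_in \<mu> \<nu> \<longleftrightarrow> (\<forall>i. row \<mu> i \<le> row \<nu> i)"
proof
  assume "contained_in \<mu> \<nu>"
  then have "j < row \<mu> i \<Longrightarrow> j < row \<nu> i" for i j
    by (auto simp: contained_in_def diagram_row)
  then show "\<forall>i. row \<mu> i \<le> row \<nu> i" by (meson leI less_irrefl)
qed (auto simp: contained_in_def diagram_row intro: less_le_trans)

lemma diagram_inject:
  assumes "is_partition \<mu>" "is_partition \<nu>" "diagram \<mu> = diagram \<nu>"
  shows "\<mu> = \<nu>"
proof (rule row_inject[OF assms(1,2)], rule ext)
  have "contained_in \<mu> \<nu>" "contained_in \<nu> \<mu>" using assms(3) by (simp_all add: contained_in_def)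
  then show "row \<mu> i = row \<nu> i" for i by (simp add: contained_in_row antisym)
qed

lemma diagram_down_closed:
  assumes "is_partition \<mu>" "(i, j) \<in> diagram \<mu>" "i' \<le> i" "j' \<le> j"
  shows "(i', j') \<in> diagram \<mu>"
  using assms row_antimono[OF assms(1,3)] by (simp add: diagram_row)

lemma contained_in_size:
  assumes "contained_in \<nu> \<mu>"
  shows "sum_list \<nu> + card (diagram \<mu> - diagram \<nu>) = sum_list \<mu>"
proof -
  have "card (diagram \<nu>) \<le> card (diagram \<mu>)"
    using assms by (intro card_mono) (auto simp: contained_in_def)
  then show ?thesis
    using assms by (simp add: contained_in_def card_Diff_subset flip: card_diagram)
qed

lemma finite_contained_partitions: "finite {\<nu>. is_partition \<nu> \<and> contained_in \<nu> \<mu>}"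
proof (rule finite_imageD)
  show "inj_on diagram {\<nu>. is_partition \<nu> \<and> contained_in \<nu> \<mu>}"
    by (rule inj_onI) (auto intro: diagram_inject)
  show "finite (diagram ` {\<nu>. is_partition \<nu> \<and> contained_in \<nu> \<mu>})"
    by (rule finite_subset[of _ "Pow (diagram \<mu>)"]) (auto simp: contained_in_def)
qed

lemma sum_list_partition_eq_0: "is_partition \<mu> \<Longrightarrow> sum_list \<mu> = 0 \<longleftrightarrow> \<mu> = []"
  by (cases \<mu>) (auto simp: is_partition_def)

lemma ex_partition_row:
  assumes "antimono f" "f L = 0"
  obtains \<mu> where "is_partition \<mu>" "row \<mu> = f"
proof
  define m where "m = (LEAST n. f n = 0)"
  have zero: "f m = 0" and pos: "\<And>i. i < m \<Longrightarrow> f i > 0"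
    using assms(2) unfolding m_def by (auto intro: LeastI dest: not_less_Least)
  show "is_partition (map f [0..<m])"
    using antimonoD[OF assms(1)] pos by (force simp: is_partition_def sorted_wrt_iff_nth_less)
  show "row (map f [0..<m]) = f"
  proof
    show "row (map f [0..<m]) i = f i" for i
      using zero antimonoD[OF assms(1), of m i] by (cases "i < m") (simp_all add: row_def)
  qed
qed

section \<open>Covers in Young's graph\<close>

lemma remove_corner:
  assumes \<mu>: "is_partition \<mu>" and corner: "row \<mu> (Suc i) < row \<mu> i"
  obtains \<kappa> where "is_partition \<kappa>" "diagram \<kappa> = diagram \<mu> - {(i, row \<mu> i - 1)}"
proof -
  obtain \<kappa> where \<kappa>: "is_partition \<kappa>" "row \<kappa> = (row \<mu>)(i := row \<mu> i - 1)"
  proof (rule ex_partition_row)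
    show "antimono ((row \<mu>)(i := row \<mu> i - 1))"
      unfolding antimono_iff_le_Suc
    proof
      show "((row \<mu>)(i := row \<mu> i - 1)) (Suc k) \<le> ((row \<mu>)(i := row \<mu> i - 1)) k" for k
        using row_antimono[OF \<mu>, of k "Suc k"] corner by auto
    qed
    show "((row \<mu>)(i := row \<mu> i - 1)) (length \<mu>) = 0"
      by (simp add: row_def)
  qed
  moreover have "diagram \<kappa> = diagram \<mu> - {(i, row \<mu> i - 1)}"
    unfolding diagram_row \<kappa>(2) by (auto split: if_splits)
  ultimately show ?thesis using that by blast
qed

lemma ex_corner_outside:
  assumes \<kappa>: "is_partition \<kappa>" and \<mu>: "is_partition \<mu>" and "contained_in \<kappa> \<mu>" "\<kappa> \<noteq> \<mu>"
  obtains i where "row \<mu> (Suc i) < row \<mu> i" "row \<kappa> i < row \<mu> i"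
proof -
  have row_le: "row \<kappa> i \<le> row \<mu> i" for i using assms(3) by (simp add: contained_in_row)
  define I where "I = {i. row \<kappa> i < row \<mu> i}"
  have "I \<subseteq> {..<length \<mu>}" using row_pos_iff[OF \<mu>] by (force simp: I_def)
  then have "finite I" by (rule finite_subset) simp
  have "row \<kappa> \<noteq> row \<mu>" using row_inject[OF \<kappa> \<mu>] assms(4) by blast
  then have "I \<noteq> {}" using row_le by (auto simp: I_def fun_eq_iff nat_less_le)
  then have "Max I \<in> I" "Suc (Max I) \<notin> I" using \<open>finite I\<close> by (auto dest: Max_ge)
  then have "row \<kappa> (Max I) < row \<mu> (Max I)" "row \<mu> (Suc (Max I)) \<le> row \<kappa> (Suc (Max I))"
    by (auto simp: I_def)
  moreover have "row \<kappa> (Suc (Max I)) \<le> row \<kappa> (Max I)" using row_antimono[OF \<kappa>] by simp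
  ultimately show ?thesis using that[of "Max I"] by simp
qed

lemma young_covers_iff_remove_cell:
  "young_covers \<kappa> \<mu> \<longleftrightarrow> is_partition \<kappa> \<and> is_partition \<mu> \<and>
     (\<exists>c\<in>diagram \<mu>. diagram \<kappa> = diagram \<mu> - {c})" (is "_ \<longleftrightarrow> ?remove_cell")
proof
  assume covers: "young_covers \<kappa> \<mu>"
  then have \<kappa>: "is_partition \<kappa>" and \<mu>: "is_partition \<mu>" and sub: "contained_in \<kappa> \<mu>" "\<kappa> \<noteq> \<mu>"
    by (simp_all add: young_covers_def)
  obtain i where corner: "row \<mu> (Suc i) < row \<mu> i" "row \<kappa> i < row \<mu> i"
    by (rule ex_corner_outside[OF \<kappa> \<mu> sub])
  let ?c = "(i, row \<mu> i - 1)"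
  obtain \<nu> where \<nu>: "is_partition \<nu>" "diagram \<nu> = diagram \<mu> - {?c}"
    by (rule remove_corner[OF \<mu> corner(1)])
  have cell: "?c \<in> diagram \<mu>" "?c \<notin> diagram \<kappa>" using corner by (auto simp: diagram_row)
  then have "contained_in \<kappa> \<nu>" "contained_in \<nu> \<mu>" "\<nu> \<noteq> \<mu>"
    using \<nu>(2) sub(1) by (auto simp: contained_in_def)
  then have "\<nu> = \<kappa>" using covers \<nu>(1) unfolding young_covers_def by blast
  then show ?remove_cell using \<kappa> \<mu> \<nu>(2) cell(1) by auto
next
  assume ?remove_cell
  then obtain c where \<kappa>: "is_partition \<kappa>" and \<mu>: "is_partition \<mu>" and cell: "c \<in> diagram \<mu>"
    and diagram: "diagram \<kappa> = diagram \<mu> - {c}" by blast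
  have "\<nu> = \<kappa> \<or> \<nu> = \<mu>" if "is_partition \<nu>" "contained_in \<kappa> \<nu>" "contained_in \<nu> \<mu>" for \<nu>
  proof -
    have "diagram \<nu> = diagram \<kappa> \<or> diagram \<nu> = diagram \<mu>"
      using that diagram by (auto simp: contained_in_def)
    then show ?thesis using diagram_inject \<kappa> \<mu> that(1) by blast
  qed
  then show "young_covers \<kappa> \<mu>"
    using \<kappa> \<mu> cell diagram by (auto simp: young_covers_def contained_in_def)
qed

lemma young_covers_iff_removes_rim_hook: "young_covers \<kappa> \<mu> \<longleftrightarrow> removes_rim_hook 1 \<mu> \<kappa>"
proof
  assume "young_covers \<kappa> \<mu>"
  then obtain i j where \<kappa>: "is_partition \<kappa>" and \<mu>: "is_partition \<mu>" and cell: "(i, j) \<in> diagram \<mu>"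
    and diagram: "diagram \<kappa> = diagram \<mu> - {(i, j)}" by (auto simp: young_covers_iff_remove_cell)
  have diff: "diagram \<mu> - diagram \<kappa> = {(i, j)}" using cell diagram by auto
  have "(Suc i, Suc j) \<notin> diagram \<mu>"
    using diagram_down_closed[OF \<kappa>, of "Suc i" "Suc j" i j] diagram by auto
  then have "{(i, j)} \<subseteq> rim \<mu>" using cell by (simp add: rim_def)
  then show "removes_rim_hook 1 \<mu> \<kappa>"
    using \<kappa> \<mu> diagram unfolding removes_rim_hook_def diff
    by (auto simp: contained_in_def connected_cells_def)
next
  assume hook: "removes_rim_hook 1 \<mu> \<kappa>"
  then obtain c where "diagram \<mu> - diagram \<kappa> = {c}" "diagram \<kappa> \<subseteq> diagram \<mu>"
    by (auto simp: removes_rim_hook_def card_1_singleton_iff contained_in_def)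
  then have "c \<in> diagram \<mu>" "diagram \<kappa> = diagram \<mu> - {c}" by auto
  then show "young_covers \<kappa> \<mu>"
    using hook by (auto simp: young_covers_iff_remove_cell removes_rim_hook_def)
qed

lemma removes_rim_hook_size: "removes_rim_hook p \<mu> \<nu> \<Longrightarrow> sum_list \<nu> + p = sum_list \<mu>"
  using contained_in_size by (auto simp: removes_rim_hook_def)

lemma young_covers_size: "young_covers \<kappa> \<mu> \<Longrightarrow> sum_list \<mu> = Suc (sum_list \<kappa>)"
  using removes_rim_hook_size[of 1] by (simp add: young_covers_iff_removes_rim_hook)

lemma finite_removes_rim_hook: "finite {\<nu>. removes_rim_hook p \<mu> \<nu>}"
  by (rule finite_subset[OF _ finite_contained_partitions[of \<mu>]]) (auto simp: removes_rim_hook_def)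

lemma finite_young_covers: "finite {\<kappa>. young_covers \<kappa> \<mu>}"
  using finite_removes_rim_hook[of 1 \<mu>] by (simp add: young_covers_iff_removes_rim_hook)

section \<open>The recursion for the number of standard tableaux\<close>

definition precedes :: "nat \<times> nat \<Rightarrow> nat \<times> nat \<Rightarrow> bool" where
  "precedes c d \<longleftrightarrow> fst c = fst d \<and> snd c < snd d \<or> fst c < fst d \<and> snd c = snd d"

lemma standard_tableaux_iff:
  "T \<in> standard_tableaux \<mu> \<longleftrightarrow>
     T \<in> extensional (diagram \<mu>) \<and> bij_betw T (diagram \<mu>) {1..sum_list \<mu>} \<and>
     (\<forall>c\<in>diagram \<mu>. \<forall>d\<in>diagram \<mu>. precedes c d \<longrightarrow> T c < T d)"
  by (auto simp: standard_tableaux_def precedes_def)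

lemma precedes_diagram:
  assumes "is_partition \<mu>" "precedes c d" "d \<in> diagram \<mu>"
  shows "c \<in> diagram \<mu>"
  using assms diagram_down_closed[OF assms(1), of "fst d" "snd d" "fst c" "snd c"]
  by (auto simp: precedes_def)

lemma finite_standard_tableaux: "finite (standard_tableaux \<mu>)"
proof (rule finite_subset)
  show "standard_tableaux \<mu> \<subseteq> (\<Pi>\<^sub>E c\<in>diagram \<mu>. {1..sum_list \<mu>})"
    by (auto simp: standard_tableaux_def PiE_def bij_betw_def)
  show "finite (\<Pi>\<^sub>E c\<in>diagram \<mu>. {1..sum_list \<mu>})"
    by (intro finite_PiE) auto
qed

definition extend_tableau :: "nat list \<Rightarrow> nat list \<Rightarrow> (nat \<times> nat \<Rightarrow> nat) \<Rightarrow> nat \<times> nat \<Rightarrow> nat" where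
  "extend_tableau \<mu> \<kappa> S = (\<lambda>c\<in>diagram \<mu>. if c \<in> diagram \<kappa> then S c else sum_list \<mu>)"

lemma standard_tableau_le:
  assumes "T \<in> standard_tableaux \<mu>" "c \<in> diagram \<mu>"
  shows "T c \<le> sum_list \<mu>"
  using assms by (auto simp: standard_tableaux_iff dest: bij_betwE)

lemma extend_tableau_standard:
  assumes covers: "young_covers \<kappa> \<mu>" and S: "S \<in> standard_tableaux \<kappa>"
  shows "extend_tableau \<mu> \<kappa> S \<in> standard_tableaux \<mu>"
proof -
  let ?n = "sum_list \<mu>" and ?T = "extend_tableau \<mu> \<kappa> S"
  obtain c where \<kappa>: "is_partition \<kappa>" and cell: "c \<notin> diagram \<kappa>" "diagram \<mu> = insert c (diagram \<kappa>)"
    using covers by (auto simp: young_covers_iff_remove_cell)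
  have size: "?n = Suc (sum_list \<kappa>)" by (rule young_covers_size[OF covers])
  have T: "?T d = (if d = c then ?n else S d)" if "d \<in> diagram \<mu>" for d
    using that cell by (auto simp: extend_tableau_def)
  have "bij_betw ?T (diagram \<kappa>) {1..sum_list \<kappa>} \<longleftrightarrow> bij_betw S (diagram \<kappa>) {1..sum_list \<kappa>}"
    using cell by (intro bij_betw_cong) (auto simp: T)
  then have "bij_betw ?T (diagram \<kappa> \<union> {c}) ({1..sum_list \<kappa>} \<union> {?T c})"
    using S cell(1) by (intro notIn_Un_bij_betw) (auto simp: T cell(2) size standard_tableaux_iff)
  then have "bij_betw ?T (diagram \<mu>) {1..?n}"
    by (simp add: T cell(2) size atLeastAtMostSuc_conv)
  moreover have "?T d < ?T e" if "d \<in> diagram \<mu>" "e \<in> diagram \<mu>" "precedes d e" for d e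
  proof (cases "e = c")
    case True
    then have "d \<in> diagram \<kappa>" using that cell(2) by (auto simp: precedes_def)
    then show ?thesis
      using standard_tableau_le[OF S, of d] True cell by (auto simp: T size)
  next
    case False
    then have "e \<in> diagram \<kappa>" "d \<in> diagram \<kappa>"
      using that cell(2) precedes_diagram[OF \<kappa> that(3)] by auto
    then show ?thesis using S that cell by (auto simp: T standard_tableaux_iff)
  qed
  ultimately show ?thesis by (simp add: standard_tableaux_iff extend_tableau_def)
qed

lemma standard_tableau_max_corner:
  assumes \<mu>: "is_partition \<mu>" "\<mu> \<noteq> []" and T: "T \<in> standard_tableaux \<mu>"
  obtains \<kappa> c where "young_covers \<kappa> \<mu>" "c \<in> diagram \<mu>" "T c = sum_list \<mu>"
    "diagram \<kappa> = diagram \<mu> - {c}"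
proof -
  have "sum_list \<mu> > 0" using \<mu> sum_list_partition_eq_0 by blast
  then have "sum_list \<mu> \<in> T ` diagram \<mu>"
    using T by (simp add: standard_tableaux_iff bij_betw_def)
  then obtain i j where cell: "(i, j) \<in> diagram \<mu>" "T (i, j) = sum_list \<mu>"
    by (metis imageE surj_pair)
  have last: "d \<notin> diagram \<mu>" if "precedes (i, j) d" for d
    by (metis T cell leD standard_tableau_le standard_tableaux_iff that)
  have "(i, Suc j) \<notin> diagram \<mu>" "(Suc i, j) \<notin> diagram \<mu>"
    by (rule last, simp add: precedes_def)+
  then have corner: "row \<mu> i = Suc j" "row \<mu> (Suc i) < row \<mu> i"
    using cell(1) by (auto simp: diagram_row)
  obtain \<kappa> where "is_partition \<kappa>" "diagram \<kappa> = diagram \<mu> - {(i, j)}"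
    using remove_corner[OF \<mu>(1) corner(2)] corner(1) by auto
  then show ?thesis using that[of \<kappa> "(i, j)"] cell \<mu>(1) by (auto simp: young_covers_iff_remove_cell)
qed

lemma standard_tableau_eq_extend:
  assumes \<mu>: "is_partition \<mu>" "\<mu> \<noteq> []" and T: "T \<in> standard_tableaux \<mu>"
  obtains \<kappa> S where "young_covers \<kappa> \<mu>" "S \<in> standard_tableaux \<kappa>" "T = extend_tableau \<mu> \<kappa> S"
proof -
  obtain \<kappa> c where covers: "young_covers \<kappa> \<mu>" and cell: "c \<in> diagram \<mu>" "T c = sum_list \<mu>"
    and diagram: "diagram \<kappa> = diagram \<mu> - {c}"
    by (rule standard_tableau_max_corner[OF assms])
  define S where "S = restrict T (diagram \<kappa>)"
  have "bij_betw T (diagram \<mu> - {c}) ({1..sum_list \<mu>} - {T c})"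
    using T cell(1) by (intro bij_betw_DiffI) (auto simp: standard_tableaux_iff bij_betw_def)
  moreover have "{1..sum_list \<mu>} - {T c} = {1..sum_list \<kappa>}"
    using cell young_covers_size[OF covers] by auto
  ultimately have "bij_betw T (diagram \<kappa>) {1..sum_list \<kappa>}" by (simp only: diagram)
  then have "bij_betw S (diagram \<kappa>) {1..sum_list \<kappa>}"
    by (rule bij_betw_cong[THEN iffD1, rotated]) (simp add: S_def)
  then have "S \<in> standard_tableaux \<kappa>"
    using T by (simp add: standard_tableaux_iff S_def diagram)
  moreover have "T = extend_tableau \<mu> \<kappa> S"
    using T cell by (auto simp: extend_tableau_def S_def diagram standard_tableaux_iff
        fun_eq_iff restrict_def extensional_def)
  ultimately show ?thesis using that covers by blast
qed

lemma extend_tableau_eq_size_iff: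
  assumes "young_covers \<kappa> \<mu>" "S \<in> standard_tableaux \<kappa>" "c \<in> diagram \<mu>"
  shows "extend_tableau \<mu> \<kappa> S c = sum_list \<mu> \<longleftrightarrow> c \<notin> diagram \<kappa>"
  using standard_tableau_le[OF assms(2), of c] young_covers_size[OF assms(1)] assms(3)
  by (auto simp: extend_tableau_def)

lemma extend_tableau_inject:
  assumes \<kappa>: "young_covers \<kappa> \<mu>" "S \<in> standard_tableaux \<kappa>"
    and \<kappa>': "young_covers \<kappa>' \<mu>" "S' \<in> standard_tableaux \<kappa>'"
    and eq: "extend_tableau \<mu> \<kappa> S = extend_tableau \<mu> \<kappa>' S'"
  shows "\<kappa> = \<kappa>'" "S = S'"
proof -
  have sub: "diagram \<kappa> \<subseteq> diagram \<mu>" "diagram \<kappa>' \<subseteq> diagram \<mu>"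
    using \<kappa>(1) \<kappa>'(1) by (auto simp: young_covers_def contained_in_def)
  then have diagram: "diagram \<kappa> = diagram \<kappa>'"
    using extend_tableau_eq_size_iff[OF \<kappa>] extend_tableau_eq_size_iff[OF \<kappa>'] eq by auto
  then show "\<kappa> = \<kappa>'" using \<kappa>(1) \<kappa>'(1) diagram_inject by (auto simp: young_covers_def)
  show "S = S'"
  proof (rule extensionalityI)
    show "S \<in> extensional (diagram \<kappa>)" "S' \<in> extensional (diagram \<kappa>)"
      using \<kappa>(2) \<kappa>'(2) diagram by (simp_all add: standard_tableaux_iff)
    show "S c = S' c" if "c \<in> diagram \<kappa>" for c
      using fun_cong[OF eq, of c] that sub diagram by (auto simp: extend_tableau_def)
  qed
qed

lemma num_syt_rec:
  assumes \<mu>: "is_partition \<mu>" "\<mu> \<noteq> []"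
  shows "num_syt \<mu> = (\<Sum>\<kappa> | young_covers \<kappa> \<mu>. num_syt \<kappa>)"
proof -
  let ?pairs = "SIGMA \<kappa>:{\<kappa>. young_covers \<kappa> \<mu>}. standard_tableaux \<kappa>"
  have "bij_betw (\<lambda>(\<kappa>, S). extend_tableau \<mu> \<kappa> S) ?pairs (standard_tableaux \<mu>)"
    unfolding bij_betw_def
  proof
    show "inj_on (\<lambda>(\<kappa>, S). extend_tableau \<mu> \<kappa> S) ?pairs"
      using extend_tableau_inject by (auto simp: inj_on_def)
    show "(\<lambda>(\<kappa>, S). extend_tableau \<mu> \<kappa> S) ` ?pairs = standard_tableaux \<mu>"
    proof (intro equalityI subsetI)
      fix T assume "T \<in> standard_tableaux \<mu>"
      then obtain \<kappa> S where "young_covers \<kappa> \<mu>" "S \<in> standard_tableaux \<kappa>"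
        "T = extend_tableau \<mu> \<kappa> S" by (rule standard_tableau_eq_extend[OF \<mu>])
      then show "T \<in> (\<lambda>(\<kappa>, S). extend_tableau \<mu> \<kappa> S) ` ?pairs" by force
    qed (auto intro: extend_tableau_standard)
  qed
  then have "num_syt \<mu> = card ?pairs" unfolding num_syt_def by (rule bij_betw_same_card[symmetric])
  also have "\<dots> = (\<Sum>\<kappa> | young_covers \<kappa> \<mu>. num_syt \<kappa>)"
    by (simp add: num_syt_def finite_standard_tableaux finite_young_covers)
  finally show ?thesis .
qed

section \<open>Partitions as bead sets\<close>

definition bead :: "nat list \<Rightarrow> nat \<Rightarrow> int" where
  "bead \<mu> i = int (row \<mu> i) - int i"

definition beads :: "nat list \<Rightarrow> int set" where
  "beads \<mu> = range (bead \<mu>)"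

definition bead_sequence :: "(nat \<Rightarrow> int) \<Rightarrow> bool" where
  "bead_sequence g \<longleftrightarrow> strict_antimono_on UNIV g \<and> (\<exists>L. \<forall>i\<ge>L. g i = - int i)"

lemma strict_antimono_SucI:
  fixes g :: "nat \<Rightarrow> int"
  assumes "\<And>i. g (Suc i) < g i"
  shows "strict_antimono_on UNIV g"
  using lift_Suc_mono_less[of "\<lambda>i. - g i"] assms by (auto intro: monotoneI)

lemma bead_sequence_bead:
  assumes "is_partition \<mu>"
  shows "bead_sequence (bead \<mu>)"
  unfolding bead_sequence_def
proof
  show "strict_antimono_on UNIV (bead \<mu>)"
  proof (rule strict_antimono_SucI)
    show "bead \<mu> (Suc i) < bead \<mu> i" for i
      using row_antimono[OF assms, of i "Suc i"] by (simp add: bead_def)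
  qed
  show "\<exists>L. \<forall>i\<ge>L. bead \<mu> i = - int i"
    by (intro exI[of _ "length \<mu>"]) (simp add: bead_def row_def)
qed

lemma bead_sequence_less:
  assumes "bead_sequence g" "i < j"
  shows "g j < g i"
  using assms by (simp add: bead_sequence_def monotone_on_def)

lemma bead_sequence_inj: "bead_sequence g \<Longrightarrow> inj g"
  by (simp add: bead_sequence_def strict_antimono_iff_antimono)

lemma bead_sequence_eqI:
  assumes "bead_sequence g" "bead_sequence h" "range g = range h"
  shows "g = h"
proof
  have pointwise_le: "u i \<le> w i"
    if u: "bead_sequence u" and w: "bead_sequence w" and range: "range u = range w"
      and below: "\<And>k. k < i \<Longrightarrow> u k = w k"
    for u w :: "nat \<Rightarrow> int" and i
  proof -
    obtain k where uw: "u i = w k" using range by blast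
    then have "\<not> k < i" using bead_sequence_less[OF u] below by force
    then show ?thesis using bead_sequence_less[OF w, of i k] uw by (cases "i = k") auto
  qed
  show "g i = h i" for i
  proof (induction i rule: less_induct)
    case (less i)
    show ?case
      using pointwise_le[of g h i] pointwise_le[of h g i] less assms by (auto intro!: antisym)
  qed
qed

lemma beads_inject:
  assumes "is_partition \<mu>" "is_partition \<nu>" "beads \<mu> = beads \<nu>"
  shows "\<mu> = \<nu>"
proof (rule row_inject[OF assms(1,2)], rule ext)
  have "bead \<mu> = bead \<nu>"
    using assms by (intro bead_sequence_eqI) (auto simp: bead_sequence_bead beads_def)
  from fun_cong[OF this] show "row \<mu> i = row \<nu> i" for i
    by (simp add: bead_def)
qed

lemma ex_partition_bead:
  assumes "bead_sequence g"
  obtains \<mu> where "is_partition \<mu>" "bead \<mu> = g"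
proof -
  define h where "h i = g i + int i" for i
  obtain L where "\<forall>i\<ge>L. g i = - int i" using assms by (auto simp: bead_sequence_def)
  then have eventually_0: "h i = 0" if "L \<le> i" for i using that by (simp add: h_def)
  have "h (Suc i) \<le> h i" for i
    using bead_sequence_less[OF assms, of i "Suc i"] by (simp add: h_def)
  then have anti: "antimono h" by (simp add: antimono_iff_le_Suc)
  have nonneg: "0 \<le> h i" for i
    using antimonoD[OF anti, of i "max i L"] eventually_0[of "max i L"] by simp
  obtain \<mu> where "is_partition \<mu>" "row \<mu> = (\<lambda>i. nat (h i))"
  proof (rule ex_partition_row)
    show "antimono (\<lambda>i. nat (h i))" using anti by (simp add: monotone_on_def nat_mono)
    show "nat (h L) = 0" by (simp add: eventually_0)
  qed
  moreover from this have "bead \<mu> = g"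
    using nonneg by (auto simp: bead_def fun_eq_iff h_def)
  ultimately show ?thesis using that by blast
qed

definition moves_bead :: "int \<Rightarrow> int set \<Rightarrow> int set \<Rightarrow> bool" where
  "moves_bead d X Y \<longleftrightarrow> (\<exists>x\<in>X. x + d \<notin> X \<and> Y = insert (x + d) (X - {x}))"

text \<open>Removing a rim hook that occupies the rows from \<open>a\<close> to \<open>b\<close> moves the bead of row \<open>a\<close> down by
  \<open>p\<close> past the beads of the other rows, which shifts the enumeration.\<close>

definition slide :: "nat \<Rightarrow> nat \<Rightarrow> nat \<Rightarrow> (nat \<Rightarrow> int) \<Rightarrow> (nat \<Rightarrow> int) \<Rightarrow> bool" where
  "slide a b p g h \<longleftrightarrow> a \<le> b \<and> h b = g a - int p \<and>
     (\<forall>i\<in>{a..<b}. h i = g (Suc i)) \<and> (\<forall>i. i \<notin> {a..b} \<longrightarrow> h i = g i)"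

lemma slideD:
  assumes "slide a b p g h"
  shows "a \<le> b" "h b = g a - int p" "i \<in> {a..<b} \<Longrightarrow> h i = g (Suc i)" "i \<notin> {a..b} \<Longrightarrow> h i = g i"
  using assms by (auto simp: slide_def)

lemma slide_range:
  assumes "inj g" "inj h" and slide: "slide a b p g h" and "p > 0"
  shows "g a - int p \<notin> range g" "range h = insert (g a - int p) (range g - {g a})"
proof -
  have "h ` {a..<b} = (\<lambda>i. g (Suc i)) ` {a..<b}"
    by (rule image_cong) (simp_all add: slideD(3)[OF slide])
  also have "\<dots> = g ` {Suc a..<Suc b}"
    by (simp only: image_Suc_atLeastLessThan image_image flip: image_image)
  finally have inner: "h ` {a..<b} = g ` {Suc a..<Suc b}" .
  have outer: "h ` (- {a..b}) = g ` (- {a..b})"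
    by (rule image_cong) (simp_all add: slideD(4)[OF slide])
  have "UNIV - {b} = {a..<b} \<union> - {a..b}" "UNIV - {a} = {Suc a..<Suc b} \<union> - {a..b}"
    using slideD(1)[OF slide] by auto
  then have others: "h ` (UNIV - {b}) = g ` (UNIV - {a})"
    by (simp only: image_Un inner outer)
  have "h b \<notin> h ` (UNIV - {b})" using \<open>inj h\<close> by (auto simp: inj_def)
  then show "g a - int p \<notin> range g"
    unfolding others slideD(2)[OF slide] using \<open>p > 0\<close> by auto
  have "range h = insert (h b) (h ` (UNIV - {b}))" by auto
  then show "range h = insert (g a - int p) (range g - {g a})"
    unfolding others slideD(2)[OF slide] by (simp add: image_set_diff[OF \<open>inj g\<close>])
qed

lemma slide_sum:
  assumes slide: "slide a b p g h"
  shows "(\<Sum>i=a..b. g i - h i) = int p"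
proof -
  have "(\<Sum>i=a..b. g i - h i) = g b - h b + (\<Sum>i=a..<b. g i - h i)"
    using slideD(1)[OF slide] by (simp add: sum.last_plus)
  also have "(\<Sum>i=a..<b. g i - h i) = - (\<Sum>i=a..<b. g (Suc i) - g i)"
    by (simp add: slideD(3)[OF slide] flip: sum_negf)
  also have "\<dots> = g a - g b" using slideD(1)[OF slide] by (simp add: sum_Suc_diff')
  finally show ?thesis using slideD(2)[OF slide] by simp
qed

lemma slide_interlaces:
  assumes g: "bead_sequence g" and h: "bead_sequence h" and slide: "slide a b p g h"
  shows "g (Suc i) \<le> h i" "h i \<le> g i"
proof -
  note slideD = slideD[OF slide]
  consider (outer) "i \<notin> {a..b}" | (inner) "i \<in> {a..<b}" | (last) "i = b" by fastforce
  then have "g (Suc i) \<le> h i \<and> h i \<le> g i"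
  proof cases
    case last
    have "h b \<le> g b"
    proof (cases "a = b")
      case False
      then have "b - 1 \<in> {a..<b}" "Suc (b - 1) = b" using slideD(1) by auto
      then show ?thesis using slideD(3)[of "b - 1"] bead_sequence_less[OF h, of "b - 1" b] by simp
    qed (simp add: slideD(2))
    then show ?thesis
      using bead_sequence_less[OF h, of b "Suc b"] slideD(4)[of "Suc b"] last by simp
  qed (use slideD bead_sequence_less[OF g, of i "Suc i"] in auto)
  then show "g (Suc i) \<le> h i" "h i \<le> g i" by blast+
qed

lemma bead_sequence_threshold:
  assumes "bead_sequence g" "y < g a"
  obtains b where "\<And>i. y < g i \<longleftrightarrow> i \<le> b"
proof -
  obtain L where "\<forall>i\<ge>L. g i = - int i" using assms(1) by (auto simp: bead_sequence_def)
  then have bounded: "g (max L (nat (- y))) \<le> y" by simp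
  define n where "n = (LEAST n. g n \<le> y)"
  have least: "g n \<le> y" "\<And>i. i < n \<Longrightarrow> y < g i"
    using bounded by (auto simp: n_def not_le intro: LeastI dest: not_less_Least)
  have "y < g i \<longleftrightarrow> i < n" for i
    using least bead_sequence_less[OF assms(1), of n i] by (cases i n rule: linorder_cases) auto
  moreover from this[of a] obtain b where "n = Suc b" using assms(2) by (cases n) auto
  ultimately show ?thesis using that[of b] by (simp add: less_Suc_eq_le)
qed

lemma ex_slide:
  assumes g: "bead_sequence g" and free: "g a - int p \<notin> range g" and p: "p > 0"
  obtains b h where "bead_sequence h" "slide a b p g h"
proof -
  let ?y = "g a - int p"
  obtain b where threshold: "\<And>i. ?y < g i \<longleftrightarrow> i \<le> b"
    using bead_sequence_threshold[OF g, of ?y a] p by auto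
  have "a \<le> b" using threshold[of a] p by simp
  have after: "g i < ?y" if "b < i" for i
    using threshold[of i] free that by (metis linorder_neqE not_le rangeI)
  define h where "h i = (if i = b then ?y else if i \<in> {a..<b} then g (Suc i) else g i)" for i
  have decreasing: "g (Suc i) < g i" for i using bead_sequence_less[OF g] by simp
  have "h (Suc i) < h i" for i
  proof -
    consider "Suc i < a" | (before) "Suc i = a" | (inner) "i \<in> {a..<b}" | "i = b" | "b < i"
      using \<open>a \<le> b\<close> by fastforce
    then show ?thesis
    proof cases
      case before
      then have "h (Suc i) \<le> g (Suc i)"
        using threshold[of a] \<open>a \<le> b\<close> p decreasing[of a] by (auto simp: h_def)
      then show ?thesis using decreasing[of i] before \<open>a \<le> b\<close> by (simp add: h_def)
    next
      case inner
      then have "?y < g (Suc i)" using threshold by auto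
      then show ?thesis using inner decreasing[of "Suc i"] by (auto simp: h_def)
    qed (use decreasing[of i] after[of "Suc b"] \<open>a \<le> b\<close> in \<open>auto simp: h_def\<close>)
  qed
  then have "strict_antimono_on UNIV h" by (rule strict_antimono_SucI)
  moreover obtain L where "\<forall>i\<ge>L. g i = - int i" using g by (auto simp: bead_sequence_def)
  then have "\<forall>i\<ge>max L (Suc b). h i = - int i" by (simp add: h_def)
  ultimately have "bead_sequence h" unfolding bead_sequence_def by blast
  moreover have "slide a b p g h" using \<open>a \<le> b\<close> by (auto simp: slide_def h_def)
  ultimately show ?thesis by (rule that)
qed

lemma card_diagram_Diff:
  assumes "\<And>i. row \<nu> i \<le> row \<mu> i" "\<And>i. i \<notin> {a..b} \<Longrightarrow> row \<nu> i = row \<mu> i"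
  shows "int (card (diagram \<mu> - diagram \<nu>)) = (\<Sum>i=a..b. bead \<mu> i - bead \<nu> i)"
proof -
  have "diagram \<mu> - diagram \<nu> = (SIGMA i:{a..b}. {row \<nu> i..<row \<mu> i})"
    using assms(2) by (force simp: diagram_row not_less)
  then have "card (diagram \<mu> - diagram \<nu>) = (\<Sum>i=a..b. row \<mu> i - row \<nu> i)" by simp
  then show ?thesis using assms(1) by (simp add: of_nat_diff bead_def)
qed

abbreviation cell_graph :: "(nat \<times> nat) set \<Rightarrow> ((nat \<times> nat) \<times> nat \<times> nat) set" where
  "cell_graph S \<equiv> {(c, d). c \<in> S \<and> d \<in> S \<and> adjacent_cells c d}"

lemma connected_cells_to_oneI:
  assumes "\<And>c. c \<in> S \<Longrightarrow> (c, d) \<in> (cell_graph S)\<^sup>*"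
  shows "connected_cells S"
proof -
  have "adjacent_cells x y \<Longrightarrow> adjacent_cells y x" for x y by (cases x; cases y) auto
  then have "sym ((cell_graph S)\<^sup>*)" by (intro sym_rtrancl) (auto simp: sym_def)
  then show ?thesis
    using assms unfolding connected_cells_def by (meson rtrancl_trans symD)
qed

lemma row_segment_connected:
  assumes "j \<le> l" "\<And>k. k \<in> {j..l} \<Longrightarrow> (i, k) \<in> S"
  shows "((i, l), (i, j)) \<in> (cell_graph S)\<^sup>*"
  using assms
proof (induction l rule: dec_induct)
  case (step l)
  then have "((i, Suc l), (i, l)) \<in> cell_graph S" "((i, l), (i, j)) \<in> (cell_graph S)\<^sup>*" by simp_all
  then show ?case by (rule converse_rtrancl_into_rtrancl)
qed simp

lemma slide_connected:
  assumes \<nu>: "is_partition \<nu>" and slide: "slide a b p (bead \<mu>) (bead \<nu>)"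
  shows "connected_cells (diagram \<mu> - diagram \<nu>)"
proof (rule connected_cells_to_oneI)
  define S where "S = diagram \<mu> - diagram \<nu>"
  have S_iff: "(i, j) \<in> S \<longleftrightarrow> row \<nu> i \<le> j \<and> j < row \<mu> i" for i j
    by (auto simp: S_def diagram_row)
  have inner: "Suc (row \<nu> i) = row \<mu> (Suc i)" if "i \<in> {a..<b}" for i
    using slideD(3)[OF slide that] by (simp add: bead_def)
  have outer: "row \<nu> i = row \<mu> i" if "i \<notin> {a..b}" for i
    using slideD(4)[OF slide that] by (simp add: bead_def)
  have left: "((i, j), (i, row \<nu> i)) \<in> (cell_graph S)\<^sup>*" if "(i, j) \<in> S" for i j
    using that by (intro row_segment_connected) (simp_all add: S_iff)
  have to_foot: "((i, j), (b, row \<nu> b)) \<in> (cell_graph S)\<^sup>*" if cell: "(i, j) \<in> S" for i j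
  proof -
    have "i \<in> {a..b}" using cell outer[of i] S_iff by force
    then have "i \<le> b" "a \<le> i" by simp_all
    then show ?thesis using cell
    proof (induction i arbitrary: j rule: inc_induct)
      case base
      then show ?case using left by blast
    next
      case (step i)
      have "row \<nu> (Suc i) \<le> row \<nu> i" using row_antimono[OF \<nu>, of i "Suc i"] by simp
      then have below: "(Suc i, row \<nu> i) \<in> S" using inner[of i] step by (simp add: S_iff)
      moreover have "(i, row \<nu> i) \<in> S" using step.prems(2) by (auto simp: S_iff)
      ultimately have "((i, row \<nu> i), (Suc i, row \<nu> i)) \<in> cell_graph S" by simp
      then show ?case
        using left[OF step.prems(2)] step.IH[OF _ below] step.prems(1)
        by (meson le_SucI rtrancl.rtrancl_into_rtrancl rtrancl_trans)
    qed
  qed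
  show "(c, (b, row \<nu> b)) \<in> (cell_graph (diagram \<mu> - diagram \<nu>))\<^sup>*"
    if "c \<in> diagram \<mu> - diagram \<nu>" for c
    using to_foot[of "fst c" "snd c"] that by (simp add: S_def)
qed

lemma slide_removes_rim_hook:
  assumes \<mu>: "is_partition \<mu>" and \<nu>: "is_partition \<nu>" and slide: "slide a b p (bead \<mu>) (bead \<nu>)"
  shows "removes_rim_hook p \<mu> \<nu>"
proof -
  note interlaces = slide_interlaces[OF bead_sequence_bead[OF \<mu>] bead_sequence_bead[OF \<nu>] slide]
  have row_le: "row \<nu> i \<le> row \<mu> i" and row_ge: "row \<mu> (Suc i) \<le> Suc (row \<nu> i)" for i
    using interlaces[of i] by (simp_all add: bead_def)
  have "row \<nu> i = row \<mu> i" if "i \<notin> {a..b}" for i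
    using slideD(4)[OF slide that] by (simp add: bead_def)
  then have "card (diagram \<mu> - diagram \<nu>) = p"
    using card_diagram_Diff[OF row_le, of a b] slide_sum[OF slide] by simp
  moreover have "(i, j) \<in> rim \<mu>" if "(i, j) \<in> diagram \<mu> - diagram \<nu>" for i j
    using that row_ge[of i] by (auto simp: rim_def diagram_row)
  then have "diagram \<mu> - diagram \<nu> \<subseteq> rim \<mu>" by auto
  ultimately show ?thesis
    using \<mu> \<nu> row_le slide_connected[OF \<nu> slide]
    by (simp add: removes_rim_hook_def contained_in_row)
qed

lemma connected_cells_crosses_rows:
  assumes "connected_cells S" "c \<in> S" "d \<in> S" "fst c \<le> i" "i < fst d"
  obtains j where "(i, j) \<in> S" "(Suc i, j) \<in> S"
proof -
  have "(c, d) \<in> (cell_graph S)\<^sup>*"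
    using assms by (simp add: connected_cells_def)
  then have "\<exists>x\<in>S. \<exists>y\<in>S. adjacent_cells x y \<and> fst x \<le> i \<and> i < fst y"
    using assms(4,5) by (induction rule: rtrancl_induct) (fastforce simp: not_le)+
  then obtain x y where "x \<in> S" "y \<in> S" "adjacent_cells x y" "fst x \<le> i" "i < fst y" by blast
  then have "x = (i, snd x)" "y = (Suc i, snd x)" by (cases x; cases y; auto)+
  then show ?thesis using that \<open>x \<in> S\<close> \<open>y \<in> S\<close> by metis
qed

lemma removes_rim_hook_row_Suc:
  assumes hook: "removes_rim_hook p \<mu> \<nu>"
    and rows: "c \<in> diagram \<mu> - diagram \<nu>" "d \<in> diagram \<mu> - diagram \<nu>" "fst c \<le> i" "i < fst d"
  shows "row \<mu> (Suc i) = Suc (row \<nu> i)"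
proof (rule antisym)
  have "connected_cells (diagram \<mu> - diagram \<nu>)" using hook by (simp add: removes_rim_hook_def)
  then obtain j where j: "(i, j) \<in> diagram \<mu> - diagram \<nu>" "(Suc i, j) \<in> diagram \<mu> - diagram \<nu>"
    by (rule connected_cells_crosses_rows[OF _ rows])
  then show "Suc (row \<nu> i) \<le> row \<mu> (Suc i)" by (auto simp: diagram_row)
  have "(i, row \<nu> i) \<in> diagram \<mu> - diagram \<nu>" using j(1) by (auto simp: diagram_row)
  then have "(i, row \<nu> i) \<in> rim \<mu>" using hook by (auto simp: removes_rim_hook_def)
  then show "row \<mu> (Suc i) \<le> Suc (row \<nu> i)" by (auto simp: rim_def diagram_row)
qed

lemma removes_rim_hook_slide:
  assumes hook: "removes_rim_hook p \<mu> \<nu>" and p: "p > 0"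
  obtains a b where "slide a b p (bead \<mu>) (bead \<nu>)"
proof -
  let ?rows = "fst ` (diagram \<mu> - diagram \<nu>)"
  have \<mu>: "is_partition \<mu>" and row_le: "\<And>i. row \<nu> i \<le> row \<mu> i"
    and card: "card (diagram \<mu> - diagram \<nu>) = p"
    using hook by (auto simp: removes_rim_hook_def contained_in_row)
  have fin: "finite ?rows" by simp
  have "diagram \<mu> - diagram \<nu> \<noteq> {}" using card p by (metis card.empty less_irrefl)
  then have nonempty: "?rows \<noteq> {}" by blast
  define a b where "a = Min ?rows" and "b = Max ?rows"
  have ends: "a \<in> ?rows" "b \<in> ?rows"
    unfolding a_def b_def using Min_in[OF fin nonempty] Max_in[OF fin nonempty] .
  have bounds: "?rows \<subseteq> {a..b}"
    unfolding a_def b_def using Min_le[OF fin] Max_ge[OF fin] by (meson atLeastAtMost_iff subsetI)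
  have "a \<le> b" using ends(1) bounds by (meson atLeastAtMost_iff subsetD)
  have outer: "row \<nu> i = row \<mu> i" if "i \<notin> {a..b}" for i
  proof -
    have "i \<notin> ?rows" using that bounds by blast
    then have "(i, row \<nu> i) \<notin> diagram \<mu> - diagram \<nu>" by force
    then show ?thesis using row_le[of i] by (simp add: diagram_row)
  qed
  have inner: "row \<mu> (Suc i) = Suc (row \<nu> i)" if "i \<in> {a..<b}" for i
    using removes_rim_hook_row_Suc[OF hook] ends that by fastforce
  define d where "d = nat (bead \<mu> a - bead \<nu> b)"
  have "bead \<nu> b \<le> bead \<mu> a"
    using row_le[of b] row_antimono[OF \<mu> \<open>a \<le> b\<close>] \<open>a \<le> b\<close> by (simp add: bead_def)
  then have slide: "slide a b d (bead \<mu>) (bead \<nu>)"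
    using \<open>a \<le> b\<close> outer inner by (auto simp: slide_def d_def bead_def)
  have "d = p"
    using slide_sum[OF slide] card_diagram_Diff[OF row_le, of a b] outer card by simp
  then show ?thesis using slide that by blast
qed

lemma moves_bead_down_partition:
  assumes "is_partition \<mu>" "p > 0" "moves_bead (- int p) (beads \<mu>) Y"
  obtains \<nu> where "removes_rim_hook p \<mu> \<nu>" "beads \<nu> = Y"
proof -
  obtain a where a: "bead \<mu> a - int p \<notin> range (bead \<mu>)"
    and Y: "Y = insert (bead \<mu> a - int p) (range (bead \<mu>) - {bead \<mu> a})"
    using assms(3) by (auto simp: moves_bead_def beads_def)
  note \<mu> = bead_sequence_bead[OF assms(1)]
  obtain b h where h: "bead_sequence h" and slide: "slide a b p (bead \<mu>) h"
    by (rule ex_slide[OF \<mu> a assms(2)])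
  obtain \<nu> where \<nu>: "is_partition \<nu>" "bead \<nu> = h" by (rule ex_partition_bead[OF h])
  show ?thesis
  proof (rule that)
    show "removes_rim_hook p \<mu> \<nu>"
      using slide_removes_rim_hook[OF assms(1) \<nu>(1)] slide \<nu>(2) by blast
    show "beads \<nu> = Y"
      using slide_range(2)[OF bead_sequence_inj[OF \<mu>] bead_sequence_inj[OF h] slide assms(2)]
      by (simp add: beads_def \<nu>(2) Y)
  qed
qed

theorem removes_rim_hook_iff_moves_bead:
  assumes "p > 0"
  shows "removes_rim_hook p \<mu> \<nu> \<longleftrightarrow>
    is_partition \<mu> \<and> is_partition \<nu> \<and> moves_bead (- int p) (beads \<mu>) (beads \<nu>)"
    (is "_ \<longleftrightarrow> ?moves")
proof
  assume hook: "removes_rim_hook p \<mu> \<nu>"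
  then have \<mu>: "is_partition \<mu>" and \<nu>: "is_partition \<nu>" by (simp_all add: removes_rim_hook_def)
  obtain a b where "slide a b p (bead \<mu>) (bead \<nu>)"
    by (rule removes_rim_hook_slide[OF hook assms])
  from slide_range[OF _ _ this assms] show ?moves
    using \<mu> \<nu> by (auto simp: moves_bead_def beads_def bead_sequence_inj bead_sequence_bead)
next
  assume moves: ?moves
  then obtain \<kappa> where \<kappa>: "removes_rim_hook p \<mu> \<kappa>" "beads \<kappa> = beads \<nu>"
    using moves_bead_down_partition[OF _ assms] by blast
  moreover from \<kappa> moves have "\<kappa> = \<nu>"
    by (intro beads_inject) (simp_all add: removes_rim_hook_def)
  ultimately show "removes_rim_hook p \<mu> \<nu>" by simp
qed

lemma moves_bead_uminus: "moves_bead (- d) Y X \<longleftrightarrow> moves_bead d X Y"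
proof -
  have "moves_bead (- d) Y X" if moves: "moves_bead d X Y" for d X Y
  proof -
    obtain x where "x \<in> X" "x + d \<notin> X" "Y = insert (x + d) (X - {x})"
      using moves by (auto simp: moves_bead_def)
    then show ?thesis unfolding moves_bead_def by (intro bexI[of _ "x + d"]) auto
  qed
  from this[of d X Y] this[of "- d" Y X] show ?thesis by auto
qed

lemma young_covers_iff_moves_bead:
  "young_covers \<mu> \<nu> \<longleftrightarrow> is_partition \<mu> \<and> is_partition \<nu> \<and> moves_bead 1 (beads \<mu>) (beads \<nu>)"
  using moves_bead_uminus[of 1 "beads \<nu>" "beads \<mu>"]
  by (auto simp: young_covers_iff_removes_rim_hook removes_rim_hook_iff_moves_bead)

lemma moves_bead_1_partition:
  assumes \<mu>: "is_partition \<mu>" and moves: "moves_bead 1 (beads \<mu>) Y"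
  obtains \<nu> where "young_covers \<mu> \<nu>" "beads \<nu> = Y"
proof -
  note seq = bead_sequence_bead[OF \<mu>]
  obtain i where free: "bead \<mu> i + 1 \<notin> range (bead \<mu>)"
    and Y: "Y = insert (bead \<mu> i + 1) (range (bead \<mu>) - {bead \<mu> i})"
    using moves by (auto simp: moves_bead_def beads_def)
  let ?h = "(bead \<mu>)(i := bead \<mu> i + 1)"
  have "?h (Suc k) < ?h k" for k
    using bead_sequence_less[OF seq, of k "Suc k"] free by (auto simp: less_le)
  then have "strict_antimono_on UNIV ?h" by (rule strict_antimono_SucI)
  moreover obtain L where "\<forall>k\<ge>L. bead \<mu> k = - int k" using seq by (auto simp: bead_sequence_def)
  then have "\<forall>k\<ge>max L (Suc i). ?h k = - int k" by simp
  ultimately have "bead_sequence ?h" unfolding bead_sequence_def by blast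
  then obtain \<nu> where \<nu>: "is_partition \<nu>" "bead \<nu> = ?h" by (rule ex_partition_bead)
  have "beads \<nu> = Y"
    using bead_sequence_inj[OF seq] by (auto simp: beads_def \<nu>(2) Y inj_def)
  then show ?thesis using that[of \<nu>] \<mu> \<nu>(1) moves by (simp add: young_covers_iff_moves_bead)
qed

section \<open>Moving two beads\<close>

lemma moves_bead_twice_same:
  assumes "x \<in> X" "x + d + e \<notin> X" "d \<noteq> 0" "e \<noteq> 0"
  shows "moves_bead d X Y \<and> moves_bead e Y (insert (x + d + e) (X - {x})) \<longleftrightarrow>
    x + d \<notin> X \<and> Y = insert (x + d) (X - {x}) \<or>
    x + e \<in> X \<and> Y = insert (x + d + e) (X - {x + e})" (is "?twice \<longleftrightarrow> ?direct \<or> ?relay")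
proof
  assume ?twice
  then obtain y z where y: "y \<in> X" "y + d \<notin> X" "Y = insert (y + d) (X - {y})"
    and z: "z \<in> Y" "z + e \<notin> Y" "insert (x + d + e) (X - {x}) = insert (z + e) (Y - {z})"
    by (auto simp: moves_bead_def)
  have mem_iff: "w = x + d + e \<or> w \<in> X \<and> w \<noteq> x \<longleftrightarrow>
      w = z + e \<or> (w = y + d \<or> w \<in> X \<and> w \<noteq> y) \<and> w \<noteq> z" for w
    using z(3) y(3) by blast
  show "?direct \<or> ?relay"
  proof (cases "y = x")
    case False
    then have "y = z + e" using mem_iff[of y] y(1,2) assms(3) by auto
    moreover have "d + e \<noteq> 0" using assms(1,2) by (auto simp: add.assoc)
    then have "z \<noteq> y + d" using \<open>y = z + e\<close> by auto
    then have "z \<in> X" "z \<noteq> y" using z(1) y(3) by auto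
    then have "z = x" using mem_iff[of z] assms(4) by auto
    ultimately show ?thesis using y by (simp add: ac_simps)
  qed (use y in auto)
next
  assume "?direct \<or> ?relay"
  then show ?twice
  proof
    assume ?direct
    then show ?twice using assms unfolding moves_bead_def
      by (intro conjI bexI[of _ x] bexI[of _ "x + d"]) auto
  next
    assume ?relay
    then show ?twice using assms unfolding moves_bead_def
      by (intro conjI bexI[of _ "x + e"] bexI[of _ x]) (auto simp: algebra_simps)
  qed
qed

definition moves_two_beads :: "int \<Rightarrow> int \<Rightarrow> int set \<Rightarrow> int set \<Rightarrow> bool" where
  "moves_two_beads d e X Z \<longleftrightarrow> (\<exists>x\<in>X. \<exists>y\<in>X. x \<noteq> y \<and> x + d \<notin> X \<and> y + e \<notin> X \<and> x + d \<noteq> y + e \<and>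
     Z = {x + d, y + e} \<union> (X - {x, y}))"

lemma moves_two_beadsE:
  assumes "moves_two_beads d e X Z"
  obtains x y where "x \<in> X" "y \<in> X" "x \<noteq> y" "x + d \<notin> X" "y + e \<notin> X" "x + d \<noteq> y + e"
    "Z = {x + d, y + e} \<union> (X - {x, y})"
  using assms unfolding moves_two_beads_def by blast

lemma moves_two_beads_commute: "moves_two_beads d e X Z \<longleftrightarrow> moves_two_beads e d X Z"
proof -
  have "moves_two_beads e d X Z" if two: "moves_two_beads d e X Z" for d e
  proof -
    obtain x y where "x \<in> X" "y \<in> X" "x \<noteq> y" "x + d \<notin> X" "y + e \<notin> X" "x + d \<noteq> y + e"
      "Z = {x + d, y + e} \<union> (X - {x, y})" using two by (rule moves_two_beadsE)
    then show ?thesis unfolding moves_two_beads_def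
      by (intro bexI[of _ y] bexI[of _ x]) (auto simp: insert_commute)
  qed
  then show ?thesis by blast
qed

lemma moves_bead_twice_cases:
  assumes "moves_bead d X Y" "moves_bead e Y Z" "d \<noteq> 0" "e \<noteq> 0" "d + e \<noteq> 0"
  shows "moves_bead (d + e) X Z \<or> moves_two_beads d e X Z"
proof -
  obtain x y where x: "x \<in> X" "x + d \<notin> X" "Y = insert (x + d) (X - {x})"
    and y: "y \<in> Y" "y + e \<notin> Y" "Z = insert (y + e) (Y - {y})"
    using assms(1,2) by (auto simp: moves_bead_def)
  consider (chain) "y = x + d" | (relay) "x = y + e" | (distinct) "y \<noteq> x + d" "x \<noteq> y + e" by blast
  then show ?thesis
  proof cases
    case chain
    then have "x + (d + e) \<notin> X" "Z = insert (x + (d + e)) (X - {x})"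
      using x y assms(5) by (auto simp: add.assoc)
    then show ?thesis using x(1) by (auto simp: moves_bead_def)
  next
    case relay
    then have "y \<in> X" using x y assms by auto
    moreover have "y + (d + e) \<notin> X" "Z = insert (y + (d + e)) (X - {y})"
      using relay x y assms by (auto simp: ac_simps)
    ultimately show ?thesis by (auto simp: moves_bead_def)
  next
    case distinct
    then have "moves_two_beads d e X Z" unfolding moves_two_beads_def
      by (intro bexI[of _ x] bexI[of _ y]) (use x y distinct in auto)
    then show ?thesis ..
  qed
qed

lemma moves_bead_twice_distinct:
  assumes "x \<in> X" "y \<in> X" "x \<noteq> y" "x + d \<notin> X" "y + e \<notin> X" "x + d \<noteq> y + e" "d \<noteq> 0" "e \<noteq> 0"
  shows "moves_bead d X Y \<and> moves_bead e Y ({x + d, y + e} \<union> (X - {x, y})) \<longleftrightarrow>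
    Y = insert (x + d) (X - {x}) \<or> d = e \<and> Y = insert (y + d) (X - {y})"
    (is "?twice \<longleftrightarrow> ?x_first \<or> ?y_first")
proof
  assume ?twice
  then obtain u w where u: "u \<in> X" "u + d \<notin> X" "Y = insert (u + d) (X - {u})"
    and w: "w \<in> Y" "w + e \<notin> Y" "{x + d, y + e} \<union> (X - {x, y}) = insert (w + e) (Y - {w})"
    by (auto simp: moves_bead_def)
  have mem_iff: "z = x + d \<or> z = y + e \<or> z \<in> X \<and> z \<noteq> x \<and> z \<noteq> y \<longleftrightarrow>
      z = w + e \<or> (z = u + d \<or> z \<in> X \<and> z \<noteq> u) \<and> z \<noteq> w" for z
    using w(3) u(3) by blast
  have "u = x \<or> u = y"
    using mem_iff[of x] mem_iff[of y] assms by auto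
  then show "?x_first \<or> ?y_first"
  proof
    assume "u = y"
    then have "w = x" "x + e = x + d"
      using mem_iff[of x] mem_iff[of "x + d"] mem_iff[of "y + e"] assms by auto
    then show ?thesis using u \<open>u = y\<close> by simp
  qed (use u in simp)
next
  assume "?x_first \<or> ?y_first"
  then show ?twice
  proof
    assume ?x_first
    then show ?twice using assms unfolding moves_bead_def
      by (intro conjI bexI[of _ x] bexI[of _ y]) auto
  next
    assume ?y_first
    then show ?twice using assms unfolding moves_bead_def
      by (intro conjI bexI[of _ x] bexI[of _ y]) auto
  qed
qed

lemma odd_card_moves_bead_twice:
  assumes "d \<noteq> 0"
  shows "odd (card {Y. moves_bead d X Y \<and> moves_bead d Y Z}) \<longleftrightarrow> moves_bead (d + d) X Z"
proof (cases "moves_bead (d + d) X Z")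
  case True
  then obtain x where x: "x \<in> X" "x + d + d \<notin> X" "Z = insert (x + d + d) (X - {x})"
    by (auto simp: moves_bead_def add.assoc)
  have "{Y. moves_bead d X Y \<and> moves_bead d Y Z} =
      {if x + d \<in> X then insert (x + d + d) (X - {x + d}) else insert (x + d) (X - {x})}"
    using moves_bead_twice_same[OF x(1,2) assms assms] x(3) by auto
  then show ?thesis using True by simp
next
  case False
  have "card {Y. moves_bead d X Y \<and> moves_bead d Y Z} \<in> {0, 2}"
  proof (cases "moves_two_beads d d X Z")
    case True
    then obtain x y where xy: "x \<in> X" "y \<in> X" "x \<noteq> y" "x + d \<notin> X" "y + d \<notin> X" "x + d \<noteq> y + d"
      and Z: "Z = {x + d, y + d} \<union> (X - {x, y})" by (rule moves_two_beadsE)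
    have "{Y. moves_bead d X Y \<and> moves_bead d Y Z} =
        {insert (x + d) (X - {x}), insert (y + d) (X - {y})}"
      using moves_bead_twice_distinct[OF xy assms assms] Z by auto
    moreover have "x \<in> insert (y + d) (X - {y})" "x \<notin> insert (x + d) (X - {x})" using xy by auto
    then have "insert (x + d) (X - {x}) \<noteq> insert (y + d) (X - {y})" by blast
    ultimately show ?thesis by simp
  next
    case neither: False
    then have none: "{Y. moves_bead d X Y \<and> moves_bead d Y Z} = {}"
      using moves_bead_twice_cases[of d X _ d Z] False assms by auto
    show ?thesis unfolding none by simp
  qed
  then show ?thesis using False by auto
qed

lemma ex1_moves_bead_twice_same:
  assumes "x \<in> X" "x + d + e \<notin> X" "d \<noteq> 0" "e \<noteq> 0"
  shows "(\<exists>!Y. moves_bead d X Y \<and> moves_bead e Y (insert (x + d + e) (X - {x}))) \<longleftrightarrow>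
    (x + d \<notin> X) \<noteq> (x + e \<in> X)"
proof -
  have "x \<notin> insert (x + d) (X - {x})" "x \<in> insert (x + d + e) (X - {x + e})" using assms by auto
  then have "insert (x + d) (X - {x}) \<noteq> insert (x + d + e) (X - {x + e})" by metis
  then show ?thesis unfolding moves_bead_twice_same[OF assms] by auto
qed

lemma ex1_moves_bead_twice_distinct:
  assumes "moves_two_beads d e X Z" "d \<noteq> 0" "e \<noteq> 0" "d \<noteq> e"
  shows "\<exists>!Y. moves_bead d X Y \<and> moves_bead e Y Z"
proof -
  obtain x y where xy: "x \<in> X" "y \<in> X" "x \<noteq> y" "x + d \<notin> X" "y + e \<notin> X" "x + d \<noteq> y + e"
    and Z: "Z = {x + d, y + e} \<union> (X - {x, y})" using assms(1) by (rule moves_two_beadsE)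
  show ?thesis unfolding Z moves_bead_twice_distinct[OF xy assms(2,3)] using assms(4) by simp
qed

text \<open>If the two moves combine to a single one of a bead \<open>x\<close>, then two of the four ways to factor it
  are available: which ones depends on whether \<open>x + d\<close> and \<open>x + e\<close> are occupied.\<close>

lemma moves_bead_swap_ex1:
  assumes "d \<noteq> 0" "e \<noteq> 0" "d \<noteq> e" "d + e \<noteq> 0"
  shows "(\<exists>!Y. moves_bead d X Y \<and> moves_bead e Y Z) \<longleftrightarrow>
    (\<exists>!W. moves_bead e X W \<and> moves_bead d W Z)"
proof -
  consider (same) "moves_bead (d + e) X Z" | (distinct) "moves_two_beads d e X Z"
    | (neither) "\<not> moves_bead (d + e) X Z" "\<not> moves_two_beads d e X Z" by blast
  then show ?thesis
  proof cases
    case same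
    then obtain x where x: "x \<in> X" "x + d + e \<notin> X" "Z = insert (x + d + e) (X - {x})"
      by (auto simp: moves_bead_def add.assoc)
    then have x': "x + e + d \<notin> X" "Z = insert (x + e + d) (X - {x})" by (simp_all add: ac_simps)
    have "(\<exists>!Y. moves_bead d X Y \<and> moves_bead e Y Z) \<longleftrightarrow> (x + d \<notin> X) \<noteq> (x + e \<in> X)"
      unfolding x(3) by (rule ex1_moves_bead_twice_same[OF x(1,2) assms(1,2)])
    also have "\<dots> \<longleftrightarrow> (x + e \<notin> X) \<noteq> (x + d \<in> X)" by blast
    also have "\<dots> \<longleftrightarrow> (\<exists>!W. moves_bead e X W \<and> moves_bead d W Z)"
      unfolding x'(2) by (rule ex1_moves_bead_twice_same[OF x(1) x'(1) assms(2,1), symmetric])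
    finally show ?thesis .
  next
    case distinct
    then have "\<exists>!Y. moves_bead d X Y \<and> moves_bead e Y Z"
      by (rule ex1_moves_bead_twice_distinct[OF _ assms(1-3)])
    moreover have "\<exists>!W. moves_bead e X W \<and> moves_bead d W Z"
      using distinct assms by (intro ex1_moves_bead_twice_distinct)
        (simp_all add: moves_two_beads_commute[of e d])
    ultimately show ?thesis by (simp only:)
  next
    case neither
    then have "\<not> moves_bead (e + d) X Z" "\<not> moves_two_beads e d X Z"
      using moves_two_beads_commute[of d e X Z] by (simp_all add: add.commute)
    then have "\<not> (moves_bead d X Y \<and> moves_bead e Y Z)" "\<not> (moves_bead e X Y \<and> moves_bead d Y Z)"
      for Y
      using moves_bead_twice_cases[of d X Y e Z] moves_bead_twice_cases[of e X Y d Z] neither assms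
      by (auto simp: add.commute)
    then show ?thesis by blast
  qed
qed

lemma moves_bead_swap_or_blocked:
  assumes moves: "moves_bead d X Y" "moves_bead e Y Z"
    and d: "d \<noteq> 0" and e: "e \<noteq> 0" "d \<noteq> e" "d + e \<noteq> 0"
  obtains (swap) W where "moves_bead e X W" "moves_bead d W Z"
  | (blocked) a where "a \<in> X" "a + e \<in> X" "a + d \<notin> X" "a + d + e \<notin> X"
    "Z = insert (a + d + e) (X - {a})"
    "Y = insert (a + d) (X - {a}) \<or> Y = insert (a + d + e) (X - {a + e})"
proof -
  consider (same) "moves_bead (d + e) X Z" | (distinct) "moves_two_beads e d X Z"
    using moves_bead_twice_cases[OF moves d e(1,3)] moves_two_beads_commute by blast
  then show thesis
  proof cases
    case distinct
    then show thesis
      using ex1_moves_bead_twice_distinct[OF distinct e(1) d e(2)[symmetric]] swap by blast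
  next
    case same
    then obtain a where a: "a \<in> X" "a + d + e \<notin> X" and Z: "Z = insert (a + d + e) (X - {a})"
      unfolding moves_bead_def add.assoc[symmetric] by blast
    then have a': "a + e + d \<notin> X" "Z = insert (a + e + d) (X - {a})" by (simp_all add: ac_simps)
    show thesis
    proof (cases "a + e \<in> X \<and> a + d \<notin> X")
      case True
      then show thesis using moves_bead_twice_same[OF a d e(1), of Y] a Z moves blocked by blast
    next
      case False
      then show thesis
        using moves_bead_twice_same[OF a(1) a'(1) e(1) d] swap unfolding a'(2) by blast
    qed
  qed
qed

text \<open>In the blocked case, the bead \<open>x\<close> that moves between \<open>X\<close> and \<open>X'\<close> stays in place on the way
  from \<open>X\<close> through \<open>Y\<close> to \<open>Y'\<close>. But it can move down in \<open>Y\<close> as well, contrary to uniqueness.\<close>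

lemma moves_bead_1_strip:
  assumes XY: "moves_bead 1 X Y" and XX': "moves_bead (- q) X X'" and YY': "moves_bead (- q) Y Y'"
    and q: "q > 1"
    and X_unique: "\<And>W. moves_bead (- q) X W \<Longrightarrow> W = X'"
    and Y_unique: "\<And>W. moves_bead (- q) Y W \<Longrightarrow> W = Y'"
    and no_double: "\<And>W. \<not> moves_bead (- (2 * q)) X W"
  shows "moves_bead 1 X' Y'"
proof -
  have "(1 :: int) \<noteq> 0" "- q \<noteq> 0" "1 \<noteq> - q" "1 + - q \<noteq> 0" using q by auto
  from XY YY' this show ?thesis
  proof (cases rule: moves_bead_swap_or_blocked)
    case (swap W)
    then show ?thesis using X_unique by blast
  next
    case (blocked a)
    obtain x where x: "x \<in> X" "x - q \<notin> X" using XX' by (auto simp: moves_bead_def)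
    have double: "z - 2 * q \<in> X" if "z \<in> X" for z
      using no_double[of "insert (z - 2 * q) (X - {z})"] that by (auto simp: moves_bead_def)
    have "x \<noteq> a" "x \<noteq> a - q" "x \<noteq> a + 1" "x - q \<noteq> a + 1"
      using x blocked double[of a] double[of x] by (auto simp: algebra_simps)
    then have "x \<in> Y" "x - q \<notin> Y" using x blocked(6) by auto
    then have "Y' = insert (x - q) (Y - {x})"
      by (intro Y_unique[symmetric]) (auto simp: moves_bead_def)
    then have "x \<notin> Y'" using q by auto
    then show ?thesis using blocked(5) x(1) \<open>x \<noteq> a\<close> by auto
  qed
qed

lemma moves_bead_diamond:
  assumes "moves_bead d X A" "moves_bead d X B" "A \<noteq> B"
  obtains C where "moves_bead d A C" "moves_bead d B C"
proof -
  obtain a b where a: "a \<in> X" "a + d \<notin> X" "A = insert (a + d) (X - {a})"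
    and b: "b \<in> X" "b + d \<notin> X" "B = insert (b + d) (X - {b})"
    using assms(1,2) by (auto simp: moves_bead_def)
  have distinct: "a \<noteq> b" "a + d \<noteq> b + d" "d \<noteq> 0" using a b assms(3) by auto
  show ?thesis
    using moves_bead_twice_distinct[OF a(1) b(1) distinct(1) a(2) b(2) distinct(2,3,3)] a(3) b(3)
    by (intro that[of "{a + d, b + d} \<union> (X - {a, b})"]) blast+
qed

section \<open>Hook removal modulo 2\<close>

lemma removes_rim_hook_diamond:
  assumes p: "p > 0" and \<alpha>: "removes_rim_hook p \<mu> \<alpha>" and \<beta>: "removes_rim_hook p \<mu> \<beta>" and "\<alpha> \<noteq> \<beta>"
  obtains \<gamma> where "removes_rim_hook p \<alpha> \<gamma>" "removes_rim_hook p \<beta> \<gamma>"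
proof -
  have partition: "is_partition \<alpha>" "is_partition \<beta>"
    and moves: "moves_bead (- int p) (beads \<mu>) (beads \<alpha>)" "moves_bead (- int p) (beads \<mu>) (beads \<beta>)"
    using \<alpha> \<beta> by (simp_all add: removes_rim_hook_iff_moves_bead[OF p])
  have "beads \<alpha> \<noteq> beads \<beta>" using beads_inject[OF partition] \<open>\<alpha> \<noteq> \<beta>\<close> by blast
  then obtain C where C: "moves_bead (- int p) (beads \<alpha>) C" "moves_bead (- int p) (beads \<beta>) C"
    by (rule moves_bead_diamond[OF moves])
  obtain \<gamma> where \<gamma>: "removes_rim_hook p \<alpha> \<gamma>" "beads \<gamma> = C"
    by (rule moves_bead_down_partition[OF partition(1) p C(1)])
  then have "removes_rim_hook p \<beta> \<gamma>"
    using C(2) partition(2) by (simp add: removes_rim_hook_iff_moves_bead[OF p])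
  with \<gamma>(1) show ?thesis by (rule that)
qed

lemma removes_rim_hook_unique:
  assumes "sum_list \<mu> < 2 * p" "removes_rim_hook p \<mu> \<alpha>" "removes_rim_hook p \<mu> \<beta>"
  shows "\<alpha> = \<beta>"
proof (rule ccontr)
  assume "\<alpha> \<noteq> \<beta>"
  moreover have "p > 0" using assms(1) by simp
  ultimately obtain \<gamma> where \<gamma>: "removes_rim_hook p \<alpha> \<gamma>"
    using removes_rim_hook_diamond assms(2,3) by blast
  show False
    using removes_rim_hook_size[OF \<gamma>] removes_rim_hook_size[OF assms(2)] assms(1) by simp
qed

lemma ex_partition_moves_bead:
  assumes "is_partition \<mu>" "d = 1 \<or> d < 0" "moves_bead d (beads \<mu>) Y"
  obtains \<nu> where "is_partition \<nu>" "beads \<nu> = Y"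
proof (cases "d = 1")
  case True
  then show ?thesis
    using moves_bead_1_partition[OF assms(1)] assms(3) that by (auto simp: young_covers_def)
next
  case False
  then have "d = - int (nat (- d))" "nat (- d) > 0" using assms(2) by simp_all
  then show ?thesis
    using moves_bead_down_partition[OF assms(1)] assms(3) that by (metis removes_rim_hook_def)
qed

lemma bij_betw_beads_between:
  assumes "is_partition \<mu>" "d = 1 \<or> d < 0"
  shows "bij_betw beads
    {\<nu>. is_partition \<nu> \<and> moves_bead d (beads \<mu>) (beads \<nu>) \<and> moves_bead e (beads \<nu>) Z}
    {Y. moves_bead d (beads \<mu>) Y \<and> moves_bead e Y Z}" (is "bij_betw _ ?P ?Q")
  unfolding bij_betw_def
proof
  show "inj_on beads ?P" by (auto intro: inj_onI beads_inject)
  show "beads ` ?P = ?Q"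
  proof (intro equalityI subsetI)
    fix Y assume Y: "Y \<in> ?Q"
    then obtain \<nu> where "is_partition \<nu>" "beads \<nu> = Y"
      using ex_partition_moves_bead[OF assms] by blast
    then show "Y \<in> beads ` ?P" using Y by blast
  qed auto
qed

text \<open>The congruence \<open>p\<^sub>m\<^sup>2 \<equiv> p\<^sub>2\<^sub>m\<close> modulo 2 for power sums, in its Murnaghan-Nakayama form.\<close>

lemma odd_card_removes_rim_hook_twice:
  assumes p: "p > 0" and \<mu>: "is_partition \<mu>" and \<kappa>: "is_partition \<kappa>"
  shows "odd (card {\<nu>. removes_rim_hook p \<mu> \<nu> \<and> removes_rim_hook p \<nu> \<kappa>}) \<longleftrightarrow>
    removes_rim_hook (2 * p) \<mu> \<kappa>"
proof -
  let ?d = "- int p"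
  have "card {\<nu>. removes_rim_hook p \<mu> \<nu> \<and> removes_rim_hook p \<nu> \<kappa>} =
      card {Y. moves_bead ?d (beads \<mu>) Y \<and> moves_bead ?d Y (beads \<kappa>)}"
    using bij_betw_same_card[OF bij_betw_beads_between[OF \<mu>, of ?d ?d "beads \<kappa>"]] p \<mu> \<kappa>
    by (simp add: removes_rim_hook_iff_moves_bead conj_ac)
  then show ?thesis
    using odd_card_moves_bead_twice[of ?d "beads \<mu>" "beads \<kappa>"] p \<mu> \<kappa>
    by (simp add: removes_rim_hook_iff_moves_bead)
qed

lemma odd_partitions_is_partition: "\<mu> \<in> odd_partitions \<Longrightarrow> is_partition \<mu>"
  by (simp add: odd_partitions_def)

lemma odd_partition_iff_odd_card_covered:
  assumes "is_partition \<mu>" "\<mu> \<noteq> []"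
  shows "\<mu> \<in> odd_partitions \<longleftrightarrow> odd (card {\<kappa> \<in> odd_partitions. young_covers \<kappa> \<mu>})"
proof -
  have "odd (num_syt \<mu>) \<longleftrightarrow> odd (card {\<kappa> \<in> {\<kappa>. young_covers \<kappa> \<mu>}. odd (num_syt \<kappa>)})"
    by (simp only: num_syt_rec[OF assms] even_sum_iff[OF finite_young_covers])
  also have "{\<kappa> \<in> {\<kappa>. young_covers \<kappa> \<mu>}. odd (num_syt \<kappa>)} =
      {\<kappa> \<in> odd_partitions. young_covers \<kappa> \<mu>}"
    by (auto simp: odd_partitions_def young_covers_def)
  finally show ?thesis using assms(1) by (simp add: odd_partitions_def)
qed

lemma odd_card_double_count:
  assumes "finite S" "finite T"
  shows "odd (card {x \<in> S. odd (card {y \<in> T. R x y})}) \<longleftrightarrow>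
    odd (card {y \<in> T. odd (card {x \<in> S. R x y})})"
proof -
  have "(\<Sum>x\<in>S. card {y \<in> T. R x y}) = (\<Sum>y\<in>T. card {x \<in> S. R x y})"
    by (rule sum_multicount_gen[OF assms]) simp
  then show ?thesis
    using even_sum_iff[OF assms(1), of "\<lambda>x. card {y \<in> T. R x y}"]
      even_sum_iff[OF assms(2), of "\<lambda>y. card {x \<in> S. R x y}"] by simp
qed

theorem odd_partition_iff_odd_card_hooks:
  assumes "is_partition \<mu>" "2 ^ k \<le> sum_list \<mu>"
  shows "\<mu> \<in> odd_partitions \<longleftrightarrow> odd (card {\<nu> \<in> odd_partitions. removes_rim_hook (2 ^ k) \<mu> \<nu>})"
  using assms
proof (induction k arbitrary: \<mu>)
  case 0
  then have "\<mu> \<noteq> []" by auto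
  then show ?case
    using odd_partition_iff_odd_card_covered[OF 0(1)]
    by (simp add: young_covers_iff_removes_rim_hook)
next
  case (Suc k)
  let ?hooks = "{\<nu>. removes_rim_hook (2 ^ k) \<mu> \<nu>}"
  define K where "K = {\<kappa> \<in> odd_partitions. contained_in \<kappa> \<mu>}"
  have "finite K"
    unfolding K_def by (rule finite_subset[OF _ finite_contained_partitions[of \<mu>]])
      (auto dest: odd_partitions_is_partition)
  have odd_hook: "\<nu> \<in> odd_partitions \<longleftrightarrow> odd (card {\<kappa> \<in> K. removes_rim_hook (2 ^ k) \<nu> \<kappa>})"
    if \<nu>: "removes_rim_hook (2 ^ k) \<mu> \<nu>" for \<nu>
  proof -
    have "2 ^ k \<le> sum_list \<nu>" using removes_rim_hook_size[OF \<nu>] Suc.prems(2) by simp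
    moreover have "{\<kappa> \<in> odd_partitions. removes_rim_hook (2 ^ k) \<nu> \<kappa>} =
        {\<kappa> \<in> K. removes_rim_hook (2 ^ k) \<nu> \<kappa>}"
      using \<nu> by (auto simp: K_def removes_rim_hook_def contained_in_def)
    ultimately show ?thesis using Suc.IH[of \<nu>] \<nu> by (simp add: removes_rim_hook_def)
  qed
  have "\<mu> \<in> odd_partitions \<longleftrightarrow> odd (card {\<nu> \<in> ?hooks. \<nu> \<in> odd_partitions})"
    using Suc.IH[OF Suc.prems(1)] Suc.prems(2) by (simp add: conj_commute)
  also have "{\<nu> \<in> ?hooks. \<nu> \<in> odd_partitions} =
      {\<nu> \<in> ?hooks. odd (card {\<kappa> \<in> K. removes_rim_hook (2 ^ k) \<nu> \<kappa>})}"
    using odd_hook by blast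
  also have "odd (card \<dots>) \<longleftrightarrow>
      odd (card {\<kappa> \<in> K. odd (card {\<nu> \<in> ?hooks. removes_rim_hook (2 ^ k) \<nu> \<kappa>})})"
    by (rule odd_card_double_count[OF finite_removes_rim_hook \<open>finite K\<close>])
  also have "{\<kappa> \<in> K. odd (card {\<nu> \<in> ?hooks. removes_rim_hook (2 ^ k) \<nu> \<kappa>})} =
      {\<kappa> \<in> odd_partitions. removes_rim_hook (2 ^ Suc k) \<mu> \<kappa>}"
    using odd_card_removes_rim_hook_twice[of "2 ^ k" \<mu>] Suc.prems(1)
    by (auto simp: K_def odd_partitions_is_partition removes_rim_hook_def[of _ \<mu>])
  finally show ?case .
qed

section \<open>Stripping the leading hook\<close>

lemma removes_leading_hook_odd_iff:
  assumes "removes_rim_hook (2 ^ k) \<mu> \<nu>" "sum_list \<mu> < 2 * 2 ^ k"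
  shows "\<mu> \<in> odd_partitions \<longleftrightarrow> \<nu> \<in> odd_partitions"
proof -
  have "{\<kappa> \<in> odd_partitions. removes_rim_hook (2 ^ k) \<mu> \<kappa>} =
      (if \<nu> \<in> odd_partitions then {\<nu>} else {})"
    using removes_rim_hook_unique[OF assms(2)] assms(1) by auto
  then show ?thesis
    using odd_partition_iff_odd_card_hooks[of \<mu> k] removes_rim_hook_size[OF assms(1)] assms(1)
    by (simp add: removes_rim_hook_def)
qed

lemma ex_odd_removes_rim_hook:
  assumes "\<mu> \<in> odd_partitions" "2 ^ k \<le> sum_list \<mu>"
  obtains \<nu> where "\<nu> \<in> odd_partitions" "removes_rim_hook (2 ^ k) \<mu> \<nu>"
proof -
  have "odd (card {\<nu> \<in> odd_partitions. removes_rim_hook (2 ^ k) \<mu> \<nu>})"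
    using odd_partition_iff_odd_card_hooks[of \<mu> k] assms by (simp add: odd_partitions_is_partition)
  then have "{\<nu> \<in> odd_partitions. removes_rim_hook (2 ^ k) \<mu> \<nu>} \<noteq> {}"
    by (metis card.empty even_zero)
  then show ?thesis using that by blast
qed

lemma young_covers_strip:
  assumes covers: "young_covers \<mu> \<nu>" and size: "sum_list \<nu> < 2 * p"
    and \<mu>: "removes_rim_hook p \<mu> \<mu>'" and \<nu>: "removes_rim_hook p \<nu> \<nu>'"
  shows "young_covers \<mu>' \<nu>'"
proof -
  have p: "p > 0" using size by simp
  have size_\<mu>: "sum_list \<mu> < 2 * p" using young_covers_size[OF covers] size by simp
  have unique: "W = beads \<alpha>"
    if hook: "removes_rim_hook p \<kappa> \<alpha>" and light: "sum_list \<kappa> < 2 * p"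
      and W: "moves_bead (- int p) (beads \<kappa>) W" for \<kappa> \<alpha> W
  proof -
    have "is_partition \<kappa>" using hook by (simp add: removes_rim_hook_def)
    then obtain \<beta> where "removes_rim_hook p \<kappa> \<beta>" "beads \<beta> = W"
      using moves_bead_down_partition[OF _ p W] by blast
    then show ?thesis using removes_rim_hook_unique[OF light hook] by simp
  qed
  have no_double: "\<not> moves_bead (- (2 * int p)) (beads \<mu>) W" for W
  proof
    assume "moves_bead (- (2 * int p)) (beads \<mu>) W"
    moreover have "is_partition \<mu>" using \<mu> by (simp add: removes_rim_hook_def)
    ultimately obtain \<kappa> where \<kappa>: "removes_rim_hook (2 * p) \<mu> \<kappa>"
      using moves_bead_down_partition[of \<mu> "2 * p" W] p by auto
    show False using removes_rim_hook_size[OF \<kappa>] size_\<mu> by simp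
  qed
  have "p > 1" using removes_rim_hook_size[OF \<mu>] young_covers_size[OF covers] size by simp
  have "moves_bead 1 (beads \<mu>') (beads \<nu>')"
  proof (rule moves_bead_1_strip[of "beads \<mu>" "beads \<nu>" "int p"])
    show "moves_bead 1 (beads \<mu>) (beads \<nu>)" using covers by (simp add: young_covers_iff_moves_bead)
    show "moves_bead (- int p) (beads \<mu>) (beads \<mu>')" "moves_bead (- int p) (beads \<nu>) (beads \<nu>')"
      using \<mu> \<nu> by (simp_all add: removes_rim_hook_iff_moves_bead[OF p])
  qed (use \<open>p > 1\<close> no_double unique[OF \<mu> size_\<mu>] unique[OF \<nu> size] in simp_all)
  then show ?thesis
    using \<mu> \<nu> by (simp add: young_covers_iff_moves_bead removes_rim_hook_def)
qed

lemma ex1_bij_betw: "bij_betw f A B \<Longrightarrow> (\<exists>!x. x \<in> A) \<longleftrightarrow> (\<exists>!y. y \<in> B)"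
  unfolding bij_betw_def inj_on_def by blast

lemma ex1_between_swap:
  assumes "is_partition \<mu>" "d = 1 \<or> d < 0" "e = 1 \<or> e < 0" "d \<noteq> e" "d + e \<noteq> 0"
  shows "(\<exists>!\<nu>. is_partition \<nu> \<and> moves_bead d (beads \<mu>) (beads \<nu>) \<and> moves_bead e (beads \<nu>) Z) \<longleftrightarrow>
    (\<exists>!\<nu>. is_partition \<nu> \<and> moves_bead e (beads \<mu>) (beads \<nu>) \<and> moves_bead d (beads \<nu>) Z)"
proof -
  have "d \<noteq> 0" "e \<noteq> 0" using assms(2,3) by auto
  then show ?thesis
    using ex1_bij_betw[OF bij_betw_beads_between[OF assms(1,2), of e Z]]
      ex1_bij_betw[OF bij_betw_beads_between[OF assms(1,3), of d Z]]
      moves_bead_swap_ex1[of d e "beads \<mu>" Z] assms(4,5)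
    unfolding mem_Collect_eq by argo
qed

lemma ex1_cover_over_strip:
  assumes \<mu>: "removes_rim_hook p \<mu> \<mu>'" and covers: "young_covers \<mu>' \<nu>'"
    and size: "Suc (sum_list \<mu>) < 2 * p"
  shows "\<exists>!\<nu>. young_covers \<mu> \<nu> \<and> removes_rim_hook p \<nu> \<nu>'"
proof -
  have p: "p > 0" "p \<noteq> 1" using size removes_rim_hook_size[OF \<mu>] by auto
  have partition: "is_partition \<mu>" "is_partition \<nu>'"
    using \<mu> covers by (simp_all add: removes_rim_hook_def young_covers_def)
  have "\<exists>!\<kappa>. removes_rim_hook p \<mu> \<kappa> \<and> young_covers \<kappa> \<nu>'"
    using \<mu> covers removes_rim_hook_unique[of \<mu> p] size by auto
  then show ?thesis
    using ex1_between_swap[of \<mu> 1 "- int p" "beads \<nu>'"] p partition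
    by (simp add: removes_rim_hook_iff_moves_bead young_covers_iff_moves_bead conj_ac)
qed

lemma ex1_covered_over_strip:
  assumes \<nu>: "removes_rim_hook p \<nu> \<nu>'" and covers: "young_covers \<mu>' \<nu>'"
    and size: "sum_list \<nu> < 2 * p"
  shows "\<exists>!\<mu>. young_covers \<mu> \<nu> \<and> removes_rim_hook p \<mu> \<mu>'"
proof -
  have p: "p > 0" "p \<noteq> 1"
    using size removes_rim_hook_size[OF \<nu>] young_covers_size[OF covers] by auto
  have partition: "is_partition \<nu>" "is_partition \<mu>'"
    using \<nu> covers by (simp_all add: removes_rim_hook_def young_covers_def)
  have "\<exists>!\<kappa>. removes_rim_hook p \<nu> \<kappa> \<and> removes_rim_hook 1 \<kappa> \<mu>'"
    using \<nu> covers removes_rim_hook_unique[of \<nu> p] size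
    by (auto simp: young_covers_iff_removes_rim_hook)
  then show ?thesis
    using ex1_between_swap[of \<nu> "- 1" "- int p" "beads \<mu>'"] p partition
    by (simp add: removes_rim_hook_iff_moves_bead young_covers_iff_removes_rim_hook conj_ac)
qed

section \<open>Odd covers\<close>

definition odd_covers :: "nat list \<Rightarrow> nat list \<Rightarrow> bool" where
  "odd_covers \<mu> \<nu> \<longleftrightarrow> \<mu> \<in> odd_partitions \<and> \<nu> \<in> odd_partitions \<and> young_covers \<mu> \<nu>"

lemma odd_covers_size: "odd_covers \<mu> \<nu> \<Longrightarrow> sum_list \<nu> = Suc (sum_list \<mu>)"
  by (simp add: odd_covers_def young_covers_size)

lemma odd_covers_strip:
  assumes "odd_covers \<mu> \<nu>" "removes_rim_hook (2 ^ k) \<mu> \<mu>'" "removes_rim_hook (2 ^ k) \<nu> \<nu>'"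
    "sum_list \<nu> < 2 * 2 ^ k"
  shows "odd_covers \<mu>' \<nu>'"
  using assms young_covers_strip[of \<mu> \<nu> "2 ^ k"] odd_covers_size[OF assms(1)]
    removes_leading_hook_odd_iff[OF assms(2)] removes_leading_hook_odd_iff[OF assms(3)]
  by (simp add: odd_covers_def)

lemma ex1_odd_cover_over_strip:
  assumes "removes_rim_hook (2 ^ k) \<mu> \<mu>'" "odd_covers \<mu>' \<nu>'" "Suc (sum_list \<mu>) < 2 * 2 ^ k"
  shows "\<exists>!\<nu>. odd_covers \<mu> \<nu> \<and> removes_rim_hook (2 ^ k) \<nu> \<nu>'"
proof -
  have "odd_covers \<mu> \<nu> \<and> removes_rim_hook (2 ^ k) \<nu> \<nu>' \<longleftrightarrow>
      young_covers \<mu> \<nu> \<and> removes_rim_hook (2 ^ k) \<nu> \<nu>'" for \<nu>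
    using assms(2,3) young_covers_size[of \<mu> \<nu>] removes_leading_hook_odd_iff[OF assms(1)]
      removes_leading_hook_odd_iff[of k \<nu> \<nu>']
    by (auto simp: odd_covers_def)
  moreover have "\<exists>!\<nu>. young_covers \<mu> \<nu> \<and> removes_rim_hook (2 ^ k) \<nu> \<nu>'"
    using assms(2)
    by (intro ex1_cover_over_strip[OF assms(1) _ assms(3)]) (simp add: odd_covers_def)
  ultimately show ?thesis by simp
qed

lemma beads_Nil: "beads [] = {..0}"
proof (intro equalityI subsetI)
  fix z :: int assume "z \<in> {..0}"
  then have "z = bead [] (nat (- z))" by (simp add: bead_def row_def)
  then show "z \<in> beads []" by (simp add: beads_def)
qed (auto simp: beads_def bead_def row_def)

lemma card_covered_by_hook_le_2:
  assumes "removes_rim_hook p \<nu> []" "p > 0"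
  shows "card {\<mu>. young_covers \<mu> \<nu>} \<le> 2"
proof -
  obtain y where y: "y \<in> beads \<nu>" "y - int p \<notin> beads \<nu>" "{..0} = insert (y - int p) (beads \<nu> - {y})"
    using assms by (auto simp: removes_rim_hook_iff_moves_bead moves_bead_def beads_Nil)
  have mem_iff: "z \<in> beads \<nu> \<longleftrightarrow> z = y \<or> z \<le> 0 \<and> z \<noteq> y - int p" for z
    using y by (auto simp: set_eq_iff)
  let ?down = "\<lambda>z. insert (z - 1) (beads \<nu> - {z})"
  have "beads ` {\<mu>. young_covers \<mu> \<nu>} \<subseteq> {?down y, ?down (y - int p + 1)}"
  proof
    fix Z assume "Z \<in> beads ` {\<mu>. young_covers \<mu> \<nu>}"
    then obtain z where z: "z \<in> beads \<nu>" "z - 1 \<notin> beads \<nu>" "Z = ?down z"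
      by (auto simp: young_covers_iff_removes_rim_hook removes_rim_hook_iff_moves_bead
          moves_bead_def)
    then have "z = y \<or> z = y - int p + 1" using mem_iff[of z] mem_iff[of "z - 1"] by auto
    then show "Z \<in> {?down y, ?down (y - int p + 1)}" using z(3) by blast
  qed
  moreover have "inj_on beads {\<mu>. young_covers \<mu> \<nu>}"
    by (auto intro: inj_onI beads_inject simp: young_covers_def)
  ultimately have "card {\<mu>. young_covers \<mu> \<nu>} \<le> card {?down y, ?down (y - int p + 1)}"
    by (intro card_inj_on_le) auto
  then show ?thesis by (simp add: card_insert_if split: if_splits)
qed

lemma odd_card_odd_parents:
  assumes "\<nu> \<in> odd_partitions" "\<nu> \<noteq> []"
  shows "odd (card {\<mu>. odd_covers \<mu> \<nu>})"
proof -
  have "{\<mu>. odd_covers \<mu> \<nu>} = {\<mu> \<in> odd_partitions. young_covers \<mu> \<nu>}"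
    using assms(1) by (auto simp: odd_covers_def)
  then show ?thesis
    using odd_partition_iff_odd_card_covered[OF odd_partitions_is_partition] assms by simp
qed

lemma ex_leading_power_of_2:
  fixes n :: nat
  assumes "n > 0"
  obtains k where "2 ^ k \<le> n" "n < 2 * 2 ^ k"
  using ex_power_ivl1[of 2 n] assms by force

lemma odd_parent_of_hook_unique:
  assumes hook: "removes_rim_hook p \<nu> []" "p > 0" and covers: "odd_covers \<mu>\<^sub>1 \<nu>" "odd_covers \<mu>\<^sub>2 \<nu>"
  shows "\<mu>\<^sub>1 = \<mu>\<^sub>2"
proof -
  have "card {\<mu>. odd_covers \<mu> \<nu>} \<le> card {\<mu>. young_covers \<mu> \<nu>}"
    by (intro card_mono finite_young_covers) (auto simp: odd_covers_def)
  also have "\<dots> \<le> 2" by (rule card_covered_by_hook_le_2[OF hook])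
  finally have "card {\<mu>. odd_covers \<mu> \<nu>} \<le> 2" .
  moreover have "\<nu> \<in> odd_partitions" "\<nu> \<noteq> []"
    using covers(1) odd_covers_size[OF covers(1)] by (auto simp: odd_covers_def)
  then have "odd (card {\<mu>. odd_covers \<mu> \<nu>})" by (rule odd_card_odd_parents)
  ultimately have "card {\<mu>. odd_covers \<mu> \<nu>} = 1" by presburger
  then obtain \<mu> where "{\<mu>. odd_covers \<mu> \<nu>} = {\<mu>}" by (rule card_1_singletonE)
  then show ?thesis using covers by (metis mem_Collect_eq singletonD)
qed

text \<open>If \<open>|\<nu>|\<close> is a power of 2, then \<open>\<nu>\<close> is a hook and covers at most two partitions; the number of
  odd ones among them is odd, hence 1. Otherwise strip the leading hook.\<close>

theorem odd_parent_unique: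
  assumes "odd_covers \<mu>\<^sub>1 \<nu>" "odd_covers \<mu>\<^sub>2 \<nu>"
  shows "\<mu>\<^sub>1 = \<mu>\<^sub>2"
  using assms
proof (induction "sum_list \<nu>" arbitrary: \<mu>\<^sub>1 \<mu>\<^sub>2 \<nu> rule: less_induct)
  case less
  note size = less.prems[THEN odd_covers_size]
  have odd: "\<nu> \<in> odd_partitions" "\<mu>\<^sub>1 \<in> odd_partitions" "\<mu>\<^sub>2 \<in> odd_partitions"
    using less.prems by (simp_all add: odd_covers_def)
  obtain k where k: "2 ^ k \<le> sum_list \<nu>" "sum_list \<nu> < 2 * 2 ^ k"
    using ex_leading_power_of_2[of "sum_list \<nu>"] size by auto
  obtain \<nu>' where \<nu>': "\<nu>' \<in> odd_partitions" "removes_rim_hook (2 ^ k) \<nu> \<nu>'"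
    by (rule ex_odd_removes_rim_hook[OF odd(1) k(1)])
  show ?case
  proof (cases "sum_list \<nu> = 2 ^ k")
    case True
    then have "sum_list \<nu>' = 0" using removes_rim_hook_size[OF \<nu>'(2)] by simp
    then have "\<nu>' = []"
      using \<nu>'(1) sum_list_partition_eq_0 odd_partitions_is_partition by blast
    then show ?thesis using odd_parent_of_hook_unique[OF _ _ less.prems] \<nu>'(2) by simp
  next
    case False
    then have size_ge: "2 ^ k \<le> sum_list \<mu>\<^sub>1" "2 ^ k \<le> sum_list \<mu>\<^sub>2" using k size by auto
    obtain \<mu>\<^sub>1' where \<mu>\<^sub>1': "removes_rim_hook (2 ^ k) \<mu>\<^sub>1 \<mu>\<^sub>1'"
      by (rule ex_odd_removes_rim_hook[OF odd(2) size_ge(1)])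
    obtain \<mu>\<^sub>2' where \<mu>\<^sub>2': "removes_rim_hook (2 ^ k) \<mu>\<^sub>2 \<mu>\<^sub>2'"
      by (rule ex_odd_removes_rim_hook[OF odd(3) size_ge(2)])
    have covers: "odd_covers \<mu>\<^sub>1' \<nu>'" "odd_covers \<mu>\<^sub>2' \<nu>'"
      using odd_covers_strip[OF _ _ \<nu>'(2) k(2)] less.prems \<mu>\<^sub>1' \<mu>\<^sub>2' by blast+
    have "sum_list \<nu>' < sum_list \<nu>"
      using removes_rim_hook_size[OF \<nu>'(2)] zero_less_power[of "2::nat" k] by linarith
    then have "\<mu>\<^sub>1' = \<mu>\<^sub>2'" using less.hyps covers by blast
    moreover have "\<exists>!\<mu>. young_covers \<mu> \<nu> \<and> removes_rim_hook (2 ^ k) \<mu> \<mu>\<^sub>1'"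
      using ex1_covered_over_strip[OF \<nu>'(2) _ k(2)] covers(1) unfolding odd_covers_def by blast
    ultimately show ?thesis using \<mu>\<^sub>1' \<mu>\<^sub>2' less.prems unfolding odd_covers_def by blast
  qed
qed

section \<open>Cores of odd partitions\<close>

lemma confluentp_removes_rim_hook:
  assumes "p > 0"
  shows "confluentp (removes_rim_hook p)"
proof (rule strong_confluentp_imp_confluentp, rule strong_confluentpI)
  show "\<exists>\<gamma>. (removes_rim_hook p)\<^sup>*\<^sup>* \<alpha> \<gamma> \<and> (removes_rim_hook p)\<^sup>=\<^sup>= \<beta> \<gamma>"
    if hooks: "removes_rim_hook p \<mu> \<alpha>" "removes_rim_hook p \<mu> \<beta>" for \<mu> \<alpha> \<beta>
  proof (cases "\<alpha> = \<beta>")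
    case False
    then obtain \<gamma> where "removes_rim_hook p \<alpha> \<gamma>" "removes_rim_hook p \<beta> \<gamma>"
      by (rule removes_rim_hook_diamond[OF assms hooks])
    then show ?thesis by blast
  qed blast
qed

lemma core_removes_rim_hook:
  assumes "removes_rim_hook p \<mu> \<nu>" "p > 0"
  shows "core p \<mu> = core p \<nu>"
proof -
  have "(removes_rim_hook p)\<^sup>*\<^sup>* \<mu> \<kappa> \<longleftrightarrow> (removes_rim_hook p)\<^sup>*\<^sup>* \<nu> \<kappa>"
    if terminal: "\<nexists>\<tau>. removes_rim_hook p \<kappa> \<tau>" for \<kappa>
  proof
    assume "(removes_rim_hook p)\<^sup>*\<^sup>* \<mu> \<kappa>"
    then obtain \<tau> where "(removes_rim_hook p)\<^sup>*\<^sup>* \<nu> \<tau>" "(removes_rim_hook p)\<^sup>*\<^sup>* \<kappa> \<tau>"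
      using confluentpD[OF confluentp_removes_rim_hook[OF assms(2)]]
        r_into_rtranclp[of "removes_rim_hook p", OF assms(1)] by blast
    moreover from this(2) have "\<tau> = \<kappa>" using terminal by (metis converse_rtranclpE)
    ultimately show "(removes_rim_hook p)\<^sup>*\<^sup>* \<nu> \<kappa>" by simp
  qed (use assms(1) in \<open>rule converse_rtranclp_into_rtranclp\<close>)
  then show ?thesis unfolding core_def by (metis (no_types, lifting))
qed

lemma core_small:
  assumes "is_partition \<mu>" "sum_list \<mu> < p"
  shows "core p \<mu> = \<mu>"
proof (cases "p = 1")
  case True
  then show ?thesis using assms sum_list_partition_eq_0 by (simp add: core_def)
next
  case False
  have terminal: "\<not> removes_rim_hook p \<mu> \<nu>" for \<nu>
    using removes_rim_hook_size[of p \<mu> \<nu>] assms(2) by auto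
  then have "(removes_rim_hook p)\<^sup>*\<^sup>* \<mu> \<nu> \<longleftrightarrow> \<nu> = \<mu>" for \<nu>
    by (metis converse_rtranclpE rtranclp.rtrancl_refl)
  then have "(removes_rim_hook p)\<^sup>*\<^sup>* \<mu> \<nu> \<and> \<not> (\<exists>\<kappa>. removes_rim_hook p \<nu> \<kappa>) \<longleftrightarrow> \<nu> = \<mu>" for \<nu>
    using terminal by auto
  then show ?thesis using False by (simp add: core_def)
qed

lemma removes_rim_hook_double:
  assumes "removes_rim_hook (2 * p) \<mu> \<kappa>" "p > 0"
  obtains \<nu> where "removes_rim_hook p \<mu> \<nu>" "removes_rim_hook p \<nu> \<kappa>"
proof -
  have "odd (card {\<nu>. removes_rim_hook p \<mu> \<nu> \<and> removes_rim_hook p \<nu> \<kappa>})"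
    using odd_card_removes_rim_hook_twice[OF assms(2)] assms(1) by (simp add: removes_rim_hook_def)
  then have "{\<nu>. removes_rim_hook p \<mu> \<nu> \<and> removes_rim_hook p \<nu> \<kappa>} \<noteq> {}"
    by (metis card.empty even_zero)
  then show ?thesis using that by blast
qed

lemma core_removes_rim_hook_power_2:
  assumes "removes_rim_hook (2 ^ k) \<mu> \<nu>" "v \<le> k"
  shows "core (2 ^ v) \<mu> = core (2 ^ v) \<nu>"
  using assms(2,1)
proof (induction k arbitrary: \<mu> \<nu> rule: dec_induct)
  case base
  then show ?case by (simp add: core_removes_rim_hook)
next
  case (step k)
  then obtain \<kappa> where "removes_rim_hook (2 ^ k) \<mu> \<kappa>" "removes_rim_hook (2 ^ k) \<kappa> \<nu>"
    using removes_rim_hook_double[of "2 ^ k" \<mu> \<nu>] by auto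
  then show ?case using step.IH by metis
qed

lemma core_leading_hook:
  assumes "removes_rim_hook (2 ^ k) \<mu> \<nu>" "sum_list \<mu> < 2 * 2 ^ k"
  shows "core (2 ^ k) \<mu> = \<nu>"
proof -
  have "sum_list \<nu> < 2 ^ k" using removes_rim_hook_size[OF assms(1)] assms(2) by simp
  then show ?thesis
    using core_removes_rim_hook[OF assms(1)] core_small[of \<nu> "2 ^ k"] assms(1)
    by (simp add: removes_rim_hook_def)
qed

lemma removes_leading_hook_core:
  assumes "\<mu> \<in> odd_partitions" "2 ^ k \<le> sum_list \<mu>" "sum_list \<mu> < 2 * 2 ^ k"
  shows "removes_rim_hook (2 ^ k) \<mu> (core (2 ^ k) \<mu>)"
proof -
  obtain \<nu> where \<nu>: "removes_rim_hook (2 ^ k) \<mu> \<nu>"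
    by (rule ex_odd_removes_rim_hook[OF assms(1,2)])
  then show ?thesis using core_leading_hook[OF \<nu> assms(3)] by simp
qed

lemma odd_partition_strip_induct [consumes 1, case_names small strip]:
  assumes "\<mu> \<in> odd_partitions"
    and small: "\<And>\<mu>. \<mu> \<in> odd_partitions \<Longrightarrow> sum_list \<mu> < 2 ^ v \<Longrightarrow> P \<mu>"
    and strip: "\<And>\<mu> \<mu>' k. \<mu> \<in> odd_partitions \<Longrightarrow> \<mu>' \<in> odd_partitions \<Longrightarrow> v \<le> k \<Longrightarrow>
      removes_rim_hook (2 ^ k) \<mu> \<mu>' \<Longrightarrow> sum_list \<mu> < 2 * 2 ^ k \<Longrightarrow> P \<mu>' \<Longrightarrow> P \<mu>"
  shows "P \<mu>"
  using assms(1)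
proof (induction "sum_list \<mu>" arbitrary: \<mu> rule: less_induct)
  case less
  show ?case
  proof (cases "sum_list \<mu> < 2 ^ v")
    case True
    then show ?thesis using less.prems by (intro small)
  next
    case False
    then have "sum_list \<mu> > 0" by (metis gr0I zero_less_numeral zero_less_power)
    then obtain k where k: "2 ^ k \<le> sum_list \<mu>" "sum_list \<mu> < 2 * 2 ^ k"
      by (rule ex_leading_power_of_2)
    have "(2::nat) ^ v < 2 ^ Suc k" using False k(2) by simp
    then have "v \<le> k" using power_less_imp_less_exp[of "2::nat" v "Suc k"] by simp
    obtain \<mu>' where \<mu>': "\<mu>' \<in> odd_partitions" "removes_rim_hook (2 ^ k) \<mu> \<mu>'"
      by (rule ex_odd_removes_rim_hook[OF less.prems k(1)])
    have "sum_list \<mu>' < sum_list \<mu>"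
      using removes_rim_hook_size[OF \<mu>'(2)] zero_less_power[of "2::nat" k] by linarith
    then have "P \<mu>'" using less.hyps \<mu>'(1) by blast
    then show ?thesis by (rule strip[OF less.prems \<mu>'(1) \<open>v \<le> k\<close> \<mu>'(2) k(2)])
  qed
qed

lemma core_odd_partition: "\<mu> \<in> odd_partitions \<Longrightarrow> core (2 ^ v) \<mu> \<in> odd_partitions"
proof (induction rule: odd_partition_strip_induct[where v = v])
  case (strip \<mu> \<mu>' k)
  then show ?case using core_removes_rim_hook_power_2[OF strip(4,3)] by simp
qed (simp add: core_small odd_partitions_is_partition)

lemma core_odd_partition_size:
  "\<mu> \<in> odd_partitions \<Longrightarrow> sum_list (core (2 ^ v) \<mu>) = sum_list \<mu> mod 2 ^ v"
proof (induction rule: odd_partition_strip_induct[where v = v])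
  case (strip \<mu> \<mu>' k)
  have "sum_list \<mu> mod 2 ^ v = sum_list \<mu>' mod 2 ^ v"
    using removes_rim_hook_size[OF strip(4)] le_imp_power_dvd[OF strip(3), of 2]
    by (metis dvd_imp_mod_0 add.right_neutral mod_add_right_eq)
  then show ?case using strip core_removes_rim_hook_power_2[OF strip(4,3)] by simp
qed (simp add: core_small odd_partitions_is_partition)

lemma bij_betw_core_odd_covers_leading:
  assumes \<mu>: "\<mu> \<in> odd_partitions" "removes_rim_hook (2 ^ k) \<mu> \<mu>'"
    and size: "Suc (sum_list \<mu>) < 2 * 2 ^ k"
  shows "bij_betw (core (2 ^ k)) {\<nu>. odd_covers \<mu> \<nu>} {\<nu>'. odd_covers \<mu>' \<nu>'}"
proof (rule bij_betw_imageI)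
  have hook: "removes_rim_hook (2 ^ k) \<nu> (core (2 ^ k) \<nu>)" and light: "sum_list \<nu> < 2 * 2 ^ k"
    and covers': "odd_covers \<mu>' (core (2 ^ k) \<nu>)" if \<nu>: "odd_covers \<mu> \<nu>" for \<nu>
  proof -
    show light: "sum_list \<nu> < 2 * 2 ^ k" using odd_covers_size[OF \<nu>] size by simp
    have "2 ^ k \<le> sum_list \<nu>" "\<nu> \<in> odd_partitions"
      using \<nu> removes_rim_hook_size[OF \<mu>(2)] odd_covers_size[OF \<nu>] by (auto simp: odd_covers_def)
    then show hook: "removes_rim_hook (2 ^ k) \<nu> (core (2 ^ k) \<nu>)"
      using removes_leading_hook_core light by blast
    show "odd_covers \<mu>' (core (2 ^ k) \<nu>)" by (rule odd_covers_strip[OF \<nu> \<mu>(2) hook light])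
  qed
  show "inj_on (core (2 ^ k)) {\<nu>. odd_covers \<mu> \<nu>}"
  proof (rule inj_onI, unfold mem_Collect_eq)
    fix \<nu>\<^sub>1 \<nu>\<^sub>2
    assume \<nu>: "odd_covers \<mu> \<nu>\<^sub>1" "odd_covers \<mu> \<nu>\<^sub>2" and "core (2 ^ k) \<nu>\<^sub>1 = core (2 ^ k) \<nu>\<^sub>2"
    then show "\<nu>\<^sub>1 = \<nu>\<^sub>2"
      using ex1_odd_cover_over_strip[OF \<mu>(2) covers'[OF \<nu>(1)] size] hook[OF \<nu>(1)] hook[OF \<nu>(2)]
      by auto
  qed
  show "core (2 ^ k) ` {\<nu>. odd_covers \<mu> \<nu>} = {\<nu>'. odd_covers \<mu>' \<nu>'}"
  proof (intro equalityI subsetI)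
    fix \<nu>' assume "\<nu>' \<in> {\<nu>'. odd_covers \<mu>' \<nu>'}"
    then obtain \<nu> where "odd_covers \<mu> \<nu>" "removes_rim_hook (2 ^ k) \<nu> \<nu>'"
      using ex1_odd_cover_over_strip[OF \<mu>(2) _ size] by blast
    then show "\<nu>' \<in> core (2 ^ k) ` {\<nu>. odd_covers \<mu> \<nu>}"
      using core_leading_hook light by blast
  qed (use covers' in auto)
qed

theorem bij_betw_core_odd_covers:
  assumes "\<mu> \<in> odd_partitions" "\<not> 2 ^ v dvd Suc (sum_list \<mu>)"
  shows "bij_betw (core (2 ^ v)) {\<nu>. odd_covers \<mu> \<nu>} {\<kappa>. odd_covers (core (2 ^ v) \<mu>) \<kappa>}"
  using assms
proof (induction rule: odd_partition_strip_induct[where v = v])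
  case (small \<mu>)
  then have "Suc (sum_list \<mu>) < 2 ^ v" using dvd_refl by (metis Suc_lessI)
  then have "core (2 ^ v) \<nu> = \<nu>" if "odd_covers \<mu> \<nu>" for \<nu>
    using that odd_covers_size[OF that]
    by (intro core_small) (auto simp: odd_covers_def odd_partitions_is_partition)
  then show ?case
    using small by (simp add: core_small odd_partitions_is_partition bij_betw_def inj_on_def)
next
  case (strip \<mu> \<mu>' k)
  have dvd: "(2::nat) ^ v dvd 2 ^ k" using strip(3) by (rule le_imp_power_dvd)
  then have "Suc (sum_list \<mu>) \<noteq> 2 * 2 ^ k" using strip.prems by auto
  then have size: "Suc (sum_list \<mu>) < 2 * 2 ^ k" using strip(5) by simp
  have "\<not> 2 ^ v dvd Suc (sum_list \<mu>')"
    using strip.prems dvd unfolding removes_rim_hook_size[OF strip(4), symmetric]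
    by (metis add_Suc dvd_add)
  then have bij: "bij_betw (core (2 ^ v) \<circ> core (2 ^ k)) {\<nu>. odd_covers \<mu> \<nu>}
      {\<kappa>. odd_covers (core (2 ^ v) \<mu>') \<kappa>}"
    using strip.IH bij_betw_core_odd_covers_leading[OF strip(1,4) size]
    by (blast intro: bij_betw_trans)
  have "(core (2 ^ v) \<circ> core (2 ^ k)) \<nu> = core (2 ^ v) \<nu>" if \<nu>: "odd_covers \<mu> \<nu>" for \<nu>
  proof -
    have "2 ^ k \<le> sum_list \<nu>" "sum_list \<nu> < 2 * 2 ^ k" "\<nu> \<in> odd_partitions"
      using \<nu> removes_rim_hook_size[OF strip(4)] odd_covers_size[OF \<nu>] size
      by (auto simp: odd_covers_def)
    then show ?thesis
      using core_removes_rim_hook_power_2[OF removes_leading_hook_core strip(3)] by simp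
  qed
  then have "bij_betw (core (2 ^ v)) {\<nu>. odd_covers \<mu> \<nu>} {\<kappa>. odd_covers (core (2 ^ v) \<mu>') \<kappa>}"
    using bij by (subst bij_betw_cong[symmetric]) simp_all
  then show ?case by (simp only: core_removes_rim_hook_power_2[OF strip(4,3)])
qed

section \<open>The tree of odd partitions\<close>

definition odd_level :: "nat list \<Rightarrow> nat \<Rightarrow> nat list set" where
  "odd_level \<rho> i = {\<mu>. odd_covers\<^sup>*\<^sup>* \<rho> \<mu> \<and> sum_list \<mu> = sum_list \<rho> + i}"

lemma odd_covers_rtranclp_size: "odd_covers\<^sup>*\<^sup>* \<mu> \<nu> \<Longrightarrow> sum_list \<mu> \<le> sum_list \<nu>"
  by (induction rule: rtranclp_induct) (auto dest: odd_covers_size)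

lemma odd_covers_rtranclp_odd: "odd_covers\<^sup>*\<^sup>* \<rho> \<mu> \<Longrightarrow> \<rho> \<in> odd_partitions \<Longrightarrow> \<mu> \<in> odd_partitions"
  by (induction rule: rtranclp_induct) (auto simp: odd_covers_def)

lemma odd_level_0: "odd_level \<rho> 0 = {\<rho>}"
proof -
  have "\<mu> = \<rho>" if "odd_covers\<^sup>*\<^sup>* \<rho> \<mu>" "sum_list \<mu> = sum_list \<rho>" for \<mu>
    using that(1)
  proof (cases rule: rtranclp.cases)
    case (rtrancl_into_rtrancl \<kappa>)
    then show ?thesis
      using odd_covers_rtranclp_size[of \<rho> \<kappa>] odd_covers_size[of \<kappa> \<mu>] that(2) by simp
  qed simp
  then show ?thesis by (auto simp: odd_level_def)
qed

lemma odd_level_Suc: "odd_level \<rho> (Suc i) = (\<Union>\<mu>\<in>odd_level \<rho> i. {\<nu>. odd_covers \<mu> \<nu>})"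
proof (intro equalityI subsetI)
  fix \<nu> assume "\<nu> \<in> odd_level \<rho> (Suc i)"
  then have "odd_covers\<^sup>*\<^sup>* \<rho> \<nu>" and size: "sum_list \<nu> = sum_list \<rho> + Suc i"
    by (simp_all add: odd_level_def)
  from this(1) show "\<nu> \<in> (\<Union>\<mu>\<in>odd_level \<rho> i. {\<nu>. odd_covers \<mu> \<nu>})"
  proof (cases rule: rtranclp.cases)
    case (rtrancl_into_rtrancl \<mu>)
    then show ?thesis using odd_covers_size[of \<mu> \<nu>] size by (auto simp: odd_level_def)
  qed (use size in simp)
next
  fix \<nu> assume "\<nu> \<in> (\<Union>\<mu>\<in>odd_level \<rho> i. {\<nu>. odd_covers \<mu> \<nu>})"
  then show "\<nu> \<in> odd_level \<rho> (Suc i)"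
    by (auto simp: odd_level_def odd_covers_size intro: rtranclp.rtrancl_into_rtrancl)
qed

lemma odd_levels_disjoint: "disjoint_family_on (odd_level \<rho>) I"
  by (auto simp: disjoint_family_on_def odd_level_def)

lemma odd_level_odd_partitions: "\<rho> \<in> odd_partitions \<Longrightarrow> odd_level \<rho> i \<subseteq> odd_partitions"
  by (auto simp: odd_level_def odd_covers_rtranclp_odd)

lemma odd_level_Suc_not_dvd:
  assumes "\<mu> \<in> odd_level \<rho> i" "q dvd sum_list \<rho>" "Suc i < q"
  shows "\<not> q dvd Suc (sum_list \<mu>)"
proof
  assume "q dvd Suc (sum_list \<mu>)"
  moreover have "Suc (sum_list \<mu>) = sum_list \<rho> + Suc i" using assms(1) by (simp add: odd_level_def)
  ultimately have "q dvd Suc i" using assms(2) by (simp only: dvd_add_right_iff)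
  then show False using assms(3) by (auto dest: dvd_imp_le)
qed

lemma core_eq_Nil:
  assumes "\<rho> \<in> odd_partitions" "2 ^ v dvd sum_list \<rho>"
  shows "core (2 ^ v) \<rho> = []"
proof -
  have "sum_list (core (2 ^ v) \<rho>) = 0" using core_odd_partition_size[OF assms(1)] assms(2) by simp
  then show ?thesis
    using core_odd_partition[OF assms(1)] sum_list_partition_eq_0 odd_partitions_is_partition
    by blast
qed

lemma bij_betw_core_odd_level:
  assumes "\<rho> \<in> odd_partitions" "2 ^ v dvd sum_list \<rho>" "i < 2 ^ v"
  shows "bij_betw (core (2 ^ v)) (odd_level \<rho> i) (odd_level [] i)"
  using assms(3)
proof (induction i)
  case 0
  then show ?case by (simp add: odd_level_0 core_eq_Nil[OF assms(1,2)] bij_betw_def)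
next
  case (Suc i)
  let ?c = "core (2 ^ v)"
  have bij: "bij_betw ?c (odd_level \<rho> i) (odd_level [] i)" using Suc by simp
  have "disjoint_family_on (\<lambda>\<mu>. {\<kappa>. odd_covers (?c \<mu>) \<kappa>}) (odd_level \<rho> i)"
    using bij_betw_imp_inj_on[OF bij]
    by (auto simp: disjoint_family_on_def dest: odd_parent_unique inj_onD)
  then have "bij_betw ?c (\<Union>\<mu>\<in>odd_level \<rho> i. {\<nu>. odd_covers \<mu> \<nu>})
      (\<Union>\<mu>\<in>odd_level \<rho> i. {\<kappa>. odd_covers (?c \<mu>) \<kappa>})"
    using odd_level_odd_partitions[OF assms(1), of i] odd_level_Suc_not_dvd[OF _ assms(2) Suc.prems]
    by (intro bij_betw_UNION_disjoint bij_betw_core_odd_covers) auto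
  also have "(\<Union>\<mu>\<in>odd_level \<rho> i. {\<kappa>. odd_covers (?c \<mu>) \<kappa>}) =
      (\<Union>\<kappa>\<in>odd_level [] i. {\<nu>. odd_covers \<kappa> \<nu>})"
    by (simp flip: bij_betw_imp_surj_on[OF bij])
  finally show ?case by (simp only: odd_level_Suc)
qed

lemma young_covers_core_iff:
  assumes \<rho>: "\<rho> \<in> odd_partitions" "2 ^ v dvd sum_list \<rho>" and less: "i < 2 ^ v" "j < 2 ^ v"
    and \<mu>: "\<mu> \<in> odd_level \<rho> i" and \<nu>: "\<nu> \<in> odd_level \<rho> j"
  shows "young_covers (core (2 ^ v) \<mu>) (core (2 ^ v) \<nu>) \<longleftrightarrow> young_covers \<mu> \<nu>"
proof (cases "j = Suc i")
  case True
  let ?c = "core (2 ^ v)"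
  have odd: "\<mu> \<in> odd_partitions" "\<nu> \<in> odd_partitions"
    using \<mu> \<nu> odd_level_odd_partitions[OF \<rho>(1)] by auto
  have image: "?c ` {\<nu>. odd_covers \<mu> \<nu>} = {\<kappa>. odd_covers (?c \<mu>) \<kappa>}"
    using bij_betw_core_odd_covers[OF odd(1) odd_level_Suc_not_dvd[OF \<mu> \<rho>(2)]] less(2) True
    by (simp add: bij_betw_def)
  have "odd_covers (?c \<mu>) (?c \<nu>) \<longleftrightarrow> odd_covers \<mu> \<nu>"
  proof
    assume "odd_covers (?c \<mu>) (?c \<nu>)"
    then obtain \<nu>' where \<nu>': "odd_covers \<mu> \<nu>'" "?c \<nu>' = ?c \<nu>" using image by force
    then have "\<nu>' \<in> odd_level \<rho> j" using \<mu> True by (auto simp: odd_level_Suc)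
    then have "\<nu>' = \<nu>"
      using bij_betw_imp_inj_on[OF bij_betw_core_odd_level[OF \<rho> less(2)]] \<nu> \<nu>'(2)
      by (auto dest: inj_onD)
    then show "odd_covers \<mu> \<nu>" using \<nu>'(1) by simp
  qed (use image in blast)
  then show ?thesis using odd core_odd_partition by (simp add: odd_covers_def)
next
  case False
  have not_covers: "\<not> young_covers \<alpha> \<beta>" if "\<alpha> \<in> odd_level \<tau> i" "\<beta> \<in> odd_level \<tau> j" for \<alpha> \<beta> \<tau>
    using that False young_covers_size[of \<alpha> \<beta>] by (auto simp: odd_level_def)
  have "core (2 ^ v) \<mu> \<in> odd_level [] i" "core (2 ^ v) \<nu> \<in> odd_level [] j"
    using bij_betwE[OF bij_betw_core_odd_level[OF \<rho> less(1)]]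
      bij_betwE[OF bij_betw_core_odd_level[OF \<rho> less(2)]] \<mu> \<nu> by blast+
  then show ?thesis using not_covers \<mu> \<nu> by blast
qed

lemma Nil_odd_partition: "[] \<in> odd_partitions"
  by (simp add: odd_partitions_def is_partition_def num_syt_def standard_tableaux_def diagram_def
      bij_betw_def)

lemma odd_subtree_levels:
  assumes "\<rho> \<in> odd_partitions"
  shows "odd_subtree \<rho> k = young_induced (\<Union>i\<le>k. odd_level \<rho> i) \<rho>"
proof -
  have "odd_tree_le = odd_covers\<^sup>*\<^sup>*"
    unfolding odd_tree_le_def
    by (rule arg_cong[of _ _ rtranclp]) (simp add: fun_eq_iff odd_covers_def)
  moreover have "\<mu> \<in> (\<Union>i\<le>k. odd_level \<rho> i)"
    if "odd_covers\<^sup>*\<^sup>* \<rho> \<mu>" "sum_list \<rho> \<le> sum_list \<mu>" "sum_list \<mu> \<le> sum_list \<rho> + k" for \<mu>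
    using that by (intro UN_I[of "sum_list \<mu> - sum_list \<rho>"]) (simp_all add: odd_level_def)
  ultimately have "{\<mu> \<in> odd_partitions. odd_tree_le \<rho> \<mu> \<and> sum_list \<rho> \<le> sum_list \<mu> \<and>
      sum_list \<mu> \<le> sum_list \<rho> + k} = (\<Union>i\<le>k. odd_level \<rho> i)"
    using odd_covers_rtranclp_odd[OF _ assms] by (auto simp: odd_level_def)
  then show ?thesis by (simp only: odd_subtree_def)
qed

lemma doubleton_young_edge: "{\<mu>, \<nu>} \<in> young_edges \<longleftrightarrow> young_covers \<mu> \<nu> \<or> young_covers \<nu> \<mu>"
  by (auto simp: young_edges_def doubleton_eq_iff)

theorem theorem3p4:
  fixes v n :: nat and \<rho> :: "nat list"
  assumes "n > 0"
    and "v \<le> multiplicity 2 n"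
    and "\<rho> \<in> odd_partitions"
    and "sum_list \<rho> = n"
  shows "rooted_graph_iso (core (2 ^ v)) (odd_subtree \<rho> (2 ^ v - 1)) (odd_subtree [] (2 ^ v - 1))"
proof -
  let ?V = "\<lambda>\<rho>. \<Union>i\<le>2 ^ v - 1. odd_level \<rho> i"
  have dvd: "2 ^ v dvd sum_list \<rho>" using assms(2,4) by (simp add: multiplicity_dvd')
  have less: "i < 2 ^ v" if "i \<in> {..2 ^ v - 1}" for i :: nat
    using that zero_less_power[of "2::nat" v] unfolding atMost_iff by linarith
  have bij: "bij_betw (core (2 ^ v)) (?V \<rho>) (?V [])"
    by (rule bij_betw_UNION_disjoint[OF odd_levels_disjoint])
      (rule bij_betw_core_odd_level[OF assms(3) dvd less])
  have covers: "young_covers (core (2 ^ v) \<mu>) (core (2 ^ v) \<nu>) \<longleftrightarrow> young_covers \<mu> \<nu>"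
    if "\<mu> \<in> ?V \<rho>" "\<nu> \<in> ?V \<rho>" for \<mu> \<nu>
    using that young_covers_core_iff[OF assms(3) dvd less less] by blast
  have "\<forall>\<mu>\<in>?V \<rho>. \<forall>\<nu>\<in>?V \<rho>. {\<mu>, \<nu>} \<in> {e \<in> young_edges. e \<subseteq> ?V \<rho>} \<longleftrightarrow>
      {core (2 ^ v) \<mu>, core (2 ^ v) \<nu>} \<in> {e \<in> young_edges. e \<subseteq> ?V []}"
    using covers bij_betwE[OF bij] by (simp add: doubleton_young_edge)
  then show ?thesis
    using bij core_eq_Nil[OF assms(3) dvd]
    by (simp add: odd_subtree_levels assms(3) Nil_odd_partition young_induced_def)
qed

end
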